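(* For each irrational $\alpha$ with bounded partial quotients, there is a function $F:\mathbb{T}\to(0,\infty)$ which is Hölder continuous with every Hölder exponent $0<\kappa<1$ and such that the functional equation $$F(x+\beta)-F(x)=g(x+\alpha)-g(x)\quad\text{for a.e. }x\in\mathbb{T}$$ has a measurable solution $g:\mathbb{T}\to\mathbb{R}$ only for $\beta\in\mathbb{Z}\alpha+\mathbb{Z}$. In other words, the liftable centralizer of the special flow $R_\alpha^F$ over the rotation $R_\alpha:x\mapsto x+\alpha\bmod 1$ under $F$ is trivial: $C^{\rm lift}(R_\alpha^F)=\{(R_\alpha^F)_t:t\in\mathbb{R}\}$.
   Context: $\mathbb{T}=[0,1)$ is the additive circle with Lebesgue measure $\mu$. For an ergodic automorphism $T$ of a standard probability space $(X,\mathcal{B},\mu)$ and $f:X\to(0,\infty)$ in $L^1$, put $f^{(n)}(x)=\sum_{i=0}^{n-1}f(T^ix)$ for $n>0$, $f^{(0)}=0$, extended to $n<0$ by $f^{(m+n)}(x)=f^{(n)}(x)+f^{(m)}(T^nx)$. The special flow $T^f$ acts on $X^f=\{(x,s):x\in X,\ 0\le s<f(x)\}$, with the normalized restriction of $\mu\otimes\lambda_{\mathbb{R}}$, by $T^f_t(x,s)=(T^nx,\,t+s-f^{(n)}(x))$, where $n$ is the unique integer with $f^{(n)}(x)\le t+s<f^{(n+1)}(x)$. Liftable centralizer. Let $T_f(x,r)=(Tx,r+f(x))$ on $X\times\mathbb{R}$. The space $X^f$ is identified with the space of $T_f$-orbits in $X\times\mathbb{R}$, the special flow becoming the quotient of $\sigma_t(x,r)=(x,r+t)$.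 If $S$ is an automorphism of $(X,\mathcal B,\mu)$ commuting with $T$ and $g:X\to\mathbb{R}$ is measurable with $f\circ S-f=g\circ T-g$ a.e., then $S_g(x,r)=(Sx,r+g(x))$ commutes with $T_f$ and with all $\sigma_t$, hence induces an automorphism $\widetilde{S_g}$ of $X^f$ commuting with $T^f$. $C^{\rm lift}(T^f)$ is the group of all such $\widetilde{S_g}$; it contains $\{T^f_t:t\in\mathbb{R}\}$. *)

theory Defs
  imports "HOL-Analysis.Analysis"
begin

section \<open>Automorphisms, cocycles and special flows\<close>

text \<open>Automorphisms are understood modulo null sets: invertibility is only required almost
  everywhere.\<close>

definition automorphism :: "'a measure \<Rightarrow> ('a \<Rightarrow> 'a) \<Rightarrow> bool" where
  "automorphism M S \<longleftrightarrow>
     S \<in> M \<rightarrow>\<^sub>M M \<and> distr M M S = M \<and>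
     (\<exists>S'. S' \<in> M \<rightarrow>\<^sub>M M \<and> (AE x in M. S' (S x) = x) \<and> (AE x in M. S (S' x) = x))"

text \<open>The element of the automorphism group represented by \<open>Q\<close>: two maps represent the same
  element iff they agree almost everywhere.\<close>

definition ae_class :: "'a measure \<Rightarrow> ('a \<Rightarrow> 'a) \<Rightarrow> ('a \<Rightarrow> 'a) set" where
  "ae_class M Q = {Q'. AE x in M. Q' x = Q x}"

text \<open>Integer iterates of a map \<open>T\<close> that is a bijection of the carrier \<open>A\<close>. In what follows the
  base automorphism \<open>T\<close> of \<open>M\<close> is always given by a representative that is a bijection of
  \<open>space M\<close>.\<close>

definition ziter :: "'a set \<Rightarrow> ('a \<Rightarrow> 'a) \<Rightarrow> int \<Rightarrow> 'a \<Rightarrow> 'a" where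
  "ziter A T n = (if n \<ge> 0 then T ^^ nat n else inv_into A T ^^ nat (- n))"

text \<open>The value at negative \<open>n\<close> is the one forced by the cocycle identity
  \<open>f\<^sup>(\<^sup>m\<^sup>+\<^sup>n\<^sup>)(x) = f\<^sup>(\<^sup>n\<^sup>)(x) + f\<^sup>(\<^sup>m\<^sup>)(T\<^sup>n x)\<close> with \<open>m = - n\<close>.\<close>

definition birkhoff_sum :: "'a measure \<Rightarrow> ('a \<Rightarrow> 'a) \<Rightarrow> ('a \<Rightarrow> real) \<Rightarrow> int \<Rightarrow> 'a \<Rightarrow> real" where
  "birkhoff_sum M T f n x =
     (if n \<ge> 0 then \<Sum>i<nat n. f ((T ^^ i) x)
      else - (\<Sum>i<nat (- n). f ((T ^^ i) (ziter (space M) T n x))))"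

definition special_space :: "'a measure \<Rightarrow> ('a \<Rightarrow> real) \<Rightarrow> ('a \<times> real) set" where
  "special_space M f = {(x, s). x \<in> space M \<and> 0 \<le> s \<and> s < f x}"

definition special_measure :: "'a measure \<Rightarrow> ('a \<Rightarrow> real) \<Rightarrow> ('a \<times> real) measure" where
  "special_measure M f =
     scale_measure (inverse (emeasure (M \<Otimes>\<^sub>M lborel) (special_space M f)))
       (restrict_space (M \<Otimes>\<^sub>M lborel) (special_space M f))"

definition special_flow ::
  "'a measure \<Rightarrow> ('a \<Rightarrow> 'a) \<Rightarrow> ('a \<Rightarrow> real) \<Rightarrow> real \<Rightarrow> 'a \<times> real \<Rightarrow> 'a \<times> real" where
  "special_flow M T f t = (\<lambda>(x, s).
     let n = (THE n::int. birkhoff_sum M T f n x \<le> t + s \<and> t + s < birkhoff_sum M T f (n + 1) x)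
     in (ziter (space M) T n x, t + s - birkhoff_sum M T f n x))"

section \<open>The liftable centralizer\<close>

definition skew :: "('a \<Rightarrow> 'a) \<Rightarrow> ('a \<Rightarrow> real) \<Rightarrow> 'a \<times> real \<Rightarrow> 'a \<times> real" where
  "skew T f = (\<lambda>(x, r). (T x, r + f x))"

definition skew_orbit ::
  "'a measure \<Rightarrow> ('a \<Rightarrow> 'a) \<Rightarrow> ('a \<Rightarrow> real) \<Rightarrow> 'a \<times> real \<Rightarrow> ('a \<times> real) set" where
  "skew_orbit M T f p = range (\<lambda>n. ziter (space M \<times> UNIV) (skew T f) n p)"

text \<open>The identification of \<open>X\<^sup>f\<close> with the space of \<open>T\<^sub>f\<close>-orbits. As \<open>T\<^sub>f\<^sup>n (x, r) =
  (T\<^sup>n x, r + f\<^sup>(\<^sup>n\<^sup>)(x))\<close> while the flow subtracts \<open>f\<^sup>(\<^sup>n\<^sup>)(x)\<close> from the height, a point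
  \<open>(x, s)\<close> of \<open>X\<^sup>f\<close> has to be identified with the orbit of \<open>(x, - s)\<close>: then the flow \<open>T\<^sup>f\<^sub>t\<close>
  is the quotient of the vertical translation of \<open>X \<times> \<real>\<close> by \<open>- t\<close>. Equivalently one may
  replace \<open>T\<^sub>f\<close> by \<open>T\<^sub>-\<^sub>f\<close> and \<open>S\<^sub>g\<close> by \<open>S\<^sub>-\<^sub>g\<close>.\<close>

definition orbit_of :: 
  "'a measure \<Rightarrow> ('a \<Rightarrow> 'a) \<Rightarrow> ('a \<Rightarrow> real) \<Rightarrow> 'a \<times> real \<Rightarrow> ('a \<times> real) set" where
  "orbit_of M T f = (\<lambda>(x, s). skew_orbit M T f (x, - s))"

text \<open>The map that \<open>S\<^sub>g\<close> induces on \<open>X\<^sup>f\<close>.\<close>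

definition induced_map ::
  "'a measure \<Rightarrow> ('a \<Rightarrow> 'a) \<Rightarrow> ('a \<Rightarrow> real) \<Rightarrow> ('a \<Rightarrow> 'a) \<Rightarrow> ('a \<Rightarrow> real)
     \<Rightarrow> 'a \<times> real \<Rightarrow> 'a \<times> real" where
  "induced_map M T f S g = (\<lambda>(x, s).
     THE q. q \<in> special_space M f \<and> orbit_of M T f q = skew_orbit M T f (skew S g (x, - s)))"

definition liftable_centralizer ::
  "'a measure \<Rightarrow> ('a \<Rightarrow> 'a) \<Rightarrow> ('a \<Rightarrow> real) \<Rightarrow> ('a \<times> real \<Rightarrow> 'a \<times> real) set set" where
  "liftable_centralizer M T f =
     {ae_class (special_measure M f) (induced_map M T f S g) | S g.
        automorphism M S \<and> (AE x in M. S (T x) = T (S x)) \<and>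
        g \<in> borel_measurable M \<and> (AE x in M. f (S x) - f x = g (T x) - g x)}"

section \<open>The circle\<close>

definition circle :: "real measure" where
  "circle = lebesgue_on {0..<1}"

definition rotation :: "real \<Rightarrow> real \<Rightarrow> real" where
  "rotation \<alpha> x = frac (x + \<alpha>)"

definition circle_dist :: "real \<Rightarrow> real \<Rightarrow> real" where
  "circle_dist x y = min (frac (x - y)) (frac (y - x))"

definition holder_on_circle :: "real \<Rightarrow> (real \<Rightarrow> real) \<Rightarrow> bool" where
  "holder_on_circle \<kappa> F \<longleftrightarrow>
     (\<exists>C. \<forall>x\<in>{0..<1}. \<forall>y\<in>{0..<1}. \<bar>F x - F y\<bar> \<le> C * circle_dist x y powr \<kappa>)"

section \<open>Continued fractions\<close>

primrec complete_quotient :: "real \<Rightarrow> nat \<Rightarrow> real" where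
  "complete_quotient \<alpha> 0 = \<alpha>"
| "complete_quotient \<alpha> (Suc n) = 1 / frac (complete_quotient \<alpha> n)"

definition partial_quotient :: "real \<Rightarrow> nat \<Rightarrow> int" where
  "partial_quotient \<alpha> n = \<lfloor>complete_quotient \<alpha> n\<rfloor>"

definition bounded_partial_quotients :: "real \<Rightarrow> bool" where
  "bounded_partial_quotients \<alpha> \<longleftrightarrow> (\<exists>B. \<forall>n\<ge>1. partial_quotient \<alpha> n \<le> B)"

end

theory Submission
  imports Defs
begin

text \<open>Let \<open>q\<^sub>k\<close> be the convergent denominators of \<open>\<alpha>\<close> and let \<open>F\<close> be a constant plus
  \<open>\<Sum>k. (k / q\<^sub>k) cos (2 \<pi> q\<^sub>k x)\<close>. If \<open>F (x + \<beta>) - F x = g (x + \<alpha>) - g x\<close>, then the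
  Birkhoff sums of the left-hand side are \<open>g (x + n \<alpha>) - g x\<close>, hence bounded in probability
  uniformly in \<open>n\<close>. For \<open>n = q\<^sub>l\<close> they are trigonometric series whose coefficients are comparable
  to \<open>k \<parallel>q\<^sub>k \<beta>\<parallel>\<close> near \<open>k = l + 1\<close> and decay geometrically in \<open>\<bar>k - l\<bar>\<close>, because \<open>\<alpha>\<close> is of
  bounded type. Choosing \<open>l\<close> so that \<open>k \<parallel>q\<^sub>k \<beta>\<parallel>\<close> is almost maximal at \<open>k = l + 1\<close>, up to slow
  exponential factors, the Fourier coefficient of frequency \<open>q\<^sub>l\<^sub>+\<^sub>1\<close> is comparable to the sup
  norm, and boundedness in probability bounds \<open>k \<parallel>q\<^sub>k \<beta>\<parallel>\<close>. So \<open>\<parallel>q\<^sub>k \<beta>\<parallel> \<longrightarrow> 0\<close>; the nearest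
  integers to \<open>q\<^sub>k \<beta>\<close> then eventually satisfy the recurrence of the convergents, which forces
  \<open>\<beta> \<in> \<int>\<alpha> + \<int>\<close>. For the centralizer, ergodicity makes an automorphism commuting with the
  rotation a rotation by some such \<open>\<beta>\<close>, and \<open>g\<close> a Birkhoff sum of \<open>F\<close> up to a constant.\<close>

section \<open>Convergents\<close>

text \<open>In the intended instance \<open>p k / q k\<close> are the convergents of \<alpha> and
  \<open>a k\<close> is the partial quotient of index k + 2, so that both recurrences start at 0.
  One constant \<open>A\<close> bounds the partial quotients and the ratios of consecutive
  denominators. Nothing else about the expansion is used later.\<close>

locale convergents =
  fixes \<alpha> :: real and q p :: "nat \<Rightarrow> int" and a :: "nat \<Rightarrow> int" and A :: real
  assumes q_pos: "1 \<le> q k"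
    and q_Suc_ge: "q k \<le> q (Suc k)"
    and a_ge: "1 \<le> a k" and a_le: "a k \<le> A"
    and q_rec: "q (Suc (Suc k)) = a k * q (Suc k) + q k"
    and p_rec: "p (Suc (Suc k)) = a k * p (Suc k) + p k"
    and det: "\<bar>q (Suc k) * p k - q k * p (Suc k)\<bar> = 1"
    and D_le: "\<bar>q k * \<alpha> - p k\<bar> \<le> 1 / q (Suc k)"
    and D_ge: "1 / (2 * q (Suc k)) \<le> \<bar>q k * \<alpha> - p k\<bar>"
    and q_Suc_le: "q (Suc k) \<le> A * q k"

section \<open>Continued fraction convergents and their approximation errors\<close>

lemma frac_irrational_bounds:
  fixes x :: real assumes "x \<notin> \<rat>" shows "0 < frac x" "frac x < 1"
proof -
  have "x \<notin> \<int>" using assms Ints_subset_Rats by blast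
  then show "0 < frac x" by (simp add: frac_gt_0_iff)
qed (rule frac_lt_1)

lemma complete_quotient_irrational:
  assumes "\<alpha> \<notin> \<rat>" shows "complete_quotient \<alpha> n \<notin> \<rat>"
proof (induction n)
  case 0 then show ?case using assms by simp
next
  case (Suc n)
  show ?case
  proof
    assume "complete_quotient \<alpha> (Suc n) \<in> \<rat>"
    then have "inverse (1 / frac (complete_quotient \<alpha> n)) \<in> \<rat>" by (intro Rats_inverse) simp
    then have "frac (complete_quotient \<alpha> n) \<in> \<rat>" by simp
    then have "frac (complete_quotient \<alpha> n) + of_int \<lfloor>complete_quotient \<alpha> n\<rfloor> \<in> \<rat>" by simp
    then show False using Suc by (simp add: frac_def)
  qed
qed

fun cf_den :: "real \<Rightarrow> nat \<Rightarrow> int" where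
  "cf_den \<alpha> 0 = 1"
| "cf_den \<alpha> (Suc 0) = partial_quotient \<alpha> 1"
| "cf_den \<alpha> (Suc (Suc k)) =
     partial_quotient \<alpha> (Suc (Suc k)) * cf_den \<alpha> (Suc k) + cf_den \<alpha> k"

fun cf_num :: "real \<Rightarrow> nat \<Rightarrow> int" where
  "cf_num \<alpha> 0 = partial_quotient \<alpha> 0"
| "cf_num \<alpha> (Suc 0) = partial_quotient \<alpha> 0 * partial_quotient \<alpha> 1 + 1"
| "cf_num \<alpha> (Suc (Suc k)) =
     partial_quotient \<alpha> (Suc (Suc k)) * cf_num \<alpha> (Suc k) + cf_num \<alpha> k"

lemma partial_quotient_ge_1:
  assumes "\<alpha> \<notin> \<rat>" shows "1 \<le> partial_quotient \<alpha> (Suc n)"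
  using frac_irrational_bounds[OF complete_quotient_irrational[OF assms, of n]]
  by (simp add: partial_quotient_def)

lemma cf_den_ge_1_mono:
  assumes "\<alpha> \<notin> \<rat>" shows "1 \<le> cf_den \<alpha> n \<and> cf_den \<alpha> n \<le> cf_den \<alpha> (Suc n)"
proof (induction n)
  case 0
  then show ?case using partial_quotient_ge_1[OF assms, of 0] by simp
next
  case (Suc n)
  have "cf_den \<alpha> (Suc n) \<le> partial_quotient \<alpha> (Suc (Suc n)) * cf_den \<alpha> (Suc n)"
    using Suc partial_quotient_ge_1[OF assms, of "Suc n"] by simp
  then show ?case using Suc unfolding cf_den.simps by linarith
qed

text \<open>The product along the Gauss map orbit; for irrational \<alpha> it is the absolute error
  |q \<alpha> - p| of the n-th convergent.\<close>

definition cf_err :: "real \<Rightarrow> nat \<Rightarrow> real" where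
  "cf_err \<alpha> n = (\<Prod>i\<le>n. frac (complete_quotient \<alpha> i))"

lemma cf_err_pos: "\<alpha> \<notin> \<rat> \<Longrightarrow> 0 < cf_err \<alpha> n"
  unfolding cf_err_def by (intro prod_pos ballI frac_irrational_bounds(1) complete_quotient_irrational)

lemma cf_err_Suc_le: "\<alpha> \<notin> \<rat> \<Longrightarrow> cf_err \<alpha> (Suc n) \<le> cf_err \<alpha> n"
  using cf_err_pos[of \<alpha> n] frac_lt_1[of "complete_quotient \<alpha> (Suc n)"]
  by (simp add: cf_err_def mult_left_le)

text \<open>The errors satisfy the recurrence of the convergents. If f and g are consecutive
  fractional parts, then g = frac (1 / f), and the recurrence becomes multiplication by f g.\<close>

lemma cf_err_eq:
  fixes \<alpha> :: real
  assumes "\<alpha> \<notin> \<rat>"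
  shows "cf_den \<alpha> n * \<alpha> - cf_num \<alpha> n = (-1) ^ n * cf_err \<alpha> n"
\<comment> \<open>The rule also varies the first argument of \<open>cf_den\<close>; a predicate that
  ignores it keeps \<alpha> fixed.\<close>
proof (induction n rule: cf_den.induct[where ?P="\<lambda>_ n. of_int (cf_den \<alpha> n) * \<alpha> - cf_num \<alpha> n = (-1) ^ n * cf_err \<alpha> n" and ?a0.0=\<alpha>])
  case 1 then show ?case by (simp add: cf_err_def frac_def partial_quotient_def)
next
  case 2
  have f0: "frac \<alpha> > 0" using frac_irrational_bounds assms by auto
  have "frac \<alpha> * partial_quotient \<alpha> 1 = 1 - frac \<alpha> * frac (1 / frac \<alpha>)"
    using f0 by (simp add: partial_quotient_def frac_def[of "1 / frac \<alpha>"] algebra_simps)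
  moreover have pq0: "partial_quotient \<alpha> 0 = \<alpha> - frac \<alpha>" by (simp add: partial_quotient_def frac_def)
  have "cf_den \<alpha> (Suc 0) * \<alpha> - cf_num \<alpha> (Suc 0) = frac \<alpha> * partial_quotient \<alpha> 1 - 1"
    by (simp add: pq0 left_diff_distrib mult.commute)
  ultimately show ?case by (simp add: cf_err_def atMost_Suc)
next
  case (3 a k)
  let ?f = "frac (complete_quotient \<alpha> (Suc k))" and ?g = "frac (complete_quotient \<alpha> (Suc (Suc k)))"
  have f0: "?f > 0" using frac_irrational_bounds complete_quotient_irrational assms by blast
  have "?g = 1 / ?f - partial_quotient \<alpha> (Suc (Suc k))"
    by (simp add: partial_quotient_def frac_def[of "1 / _"])
  then have *: "?f * partial_quotient \<alpha> (Suc (Suc k)) = 1 - ?f * ?g"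
    using f0 by (simp add: field_simps)
  have "cf_den \<alpha> (Suc (Suc k)) * \<alpha> - cf_num \<alpha> (Suc (Suc k)) =
     partial_quotient \<alpha> (Suc (Suc k)) * (cf_den \<alpha> (Suc k) * \<alpha> - cf_num \<alpha> (Suc k)) +
     (cf_den \<alpha> k * \<alpha> - cf_num \<alpha> k)" by (simp add: algebra_simps)
  also have "\<dots> = (-1) ^ k * cf_err \<alpha> k * (1 - ?f * partial_quotient \<alpha> (Suc (Suc k)))"
    unfolding 3 by (simp add: cf_err_def algebra_simps)
  also have "\<dots> = (-1) ^ (Suc (Suc k)) * cf_err \<alpha> (Suc (Suc k))"
    unfolding * by (simp add: cf_err_def algebra_simps)
  finally show ?case .
qed

lemma cf_det: "cf_den \<alpha> (Suc n) * cf_num \<alpha> n - cf_den \<alpha> n * cf_num \<alpha> (Suc n) = (-1) ^ Suc n"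
  by (induction n) (simp_all add: algebra_simps)

text \<open>Eliminating \<alpha> between two consecutive instances of \<open>cf_err_eq\<close>
  leaves the determinant. Both the upper and the lower bound on the error are read off from this
  identity.\<close>

lemma cf_err_sum:
  fixes \<alpha> :: real
  assumes "\<alpha> \<notin> \<rat>"
  shows "cf_den \<alpha> (Suc n) * cf_err \<alpha> n + cf_den \<alpha> n * cf_err \<alpha> (Suc n) = 1"
proof -
  have "(-1) ^ n * (cf_den \<alpha> (Suc n) * cf_err \<alpha> n + cf_den \<alpha> n * cf_err \<alpha> (Suc n))
    = cf_den \<alpha> (Suc n) * ((-1) ^ n * cf_err \<alpha> n) - cf_den \<alpha> n * ((-1) ^ Suc n * cf_err \<alpha> (Suc n))"
    by (simp add: algebra_simps)
  also have "\<dots> = - real_of_int (cf_den \<alpha> (Suc n) * cf_num \<alpha> n - cf_den \<alpha> n * cf_num \<alpha> (Suc n))"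
    unfolding cf_err_eq[OF assms, symmetric] by (simp add: algebra_simps)
  also have "\<dots> = (-1) ^ n" unfolding cf_det by simp
  finally show ?thesis by simp
qed

lemma bounded_partial_quotients_convergents:
  assumes "\<alpha> \<notin> \<rat>" "bounded_partial_quotients \<alpha>"
  obtains q p a A where "convergents \<alpha> q p a A"
proof -
  obtain B where B: "\<And>n. n \<ge> 1 \<Longrightarrow> partial_quotient \<alpha> n \<le> B"
    using assms(2) unfolding bounded_partial_quotients_def by blast
  note mono = cf_den_ge_1_mono[OF assms(1)]
  have pos: "0 < real_of_int (cf_den \<alpha> k)" for k using mono[of k] by simp
  have abs: "\<bar>cf_den \<alpha> k * \<alpha> - cf_num \<alpha> k\<bar> = cf_err \<alpha> k" for k
    unfolding cf_err_eq[OF assms(1)] using cf_err_pos[OF assms(1), of k]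
    by (simp add: abs_mult power_abs)
  \<comment> \<open>The bound is B + 1 because the next denominator is a partial quotient times the
    current one plus a predecessor no larger than the current one.\<close>
  have "convergents \<alpha> (cf_den \<alpha>) (cf_num \<alpha>) (\<lambda>k. partial_quotient \<alpha> (Suc (Suc k))) (of_int B + 1)"
  proof
    fix k
    note s = cf_err_sum[OF assms(1), of k] cf_err_pos[OF assms(1)]
    show "1 \<le> cf_den \<alpha> k" "cf_den \<alpha> k \<le> cf_den \<alpha> (Suc k)" using mono by auto
    show "1 \<le> partial_quotient \<alpha> (Suc (Suc k))" using partial_quotient_ge_1 assms by blast
    show "real_of_int (partial_quotient \<alpha> (Suc (Suc k))) \<le> of_int B + 1"
      using B[of "Suc (Suc k)"] by simp
    show "\<bar>cf_den \<alpha> (Suc k) * cf_num \<alpha> k - cf_den \<alpha> k * cf_num \<alpha> (Suc k)\<bar> = 1"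
      unfolding cf_det by simp
    have "cf_den \<alpha> (Suc k) * cf_err \<alpha> k \<le> 1"
      using s(1) mult_pos_pos[OF pos[of k] s(2)[of "Suc k"]] by linarith
    then show "\<bar>cf_den \<alpha> k * \<alpha> - cf_num \<alpha> k\<bar> \<le> 1 / cf_den \<alpha> (Suc k)"
      unfolding abs using pos[of "Suc k"] by (simp add: field_simps)
    \<comment> \<open>In \<open>cf_err_sum\<close> the second summand is at most the first, so the
      first is at least 1/2.\<close>
    have "cf_den \<alpha> k * cf_err \<alpha> (Suc k) \<le> cf_den \<alpha> (Suc k) * cf_err \<alpha> k"
      by (intro mult_mono) (use mono[of k] mono[of "Suc k"] cf_err_Suc_le[OF assms(1), of k] s(2)[of "Suc k"] in auto)
    then show "1 / (2 * cf_den \<alpha> (Suc k)) \<le> \<bar>cf_den \<alpha> k * \<alpha> - cf_num \<alpha> k\<bar>"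
      unfolding abs using pos[of "Suc k"] s(1) by (simp add: field_simps)
    have "cf_den \<alpha> (Suc k) \<le> (B + 1) * cf_den \<alpha> k"
    proof (cases k)
      case 0 then show ?thesis using B[of 1] by simp
    next
      case (Suc j)
      have "partial_quotient \<alpha> (Suc k) * cf_den \<alpha> k \<le> B * cf_den \<alpha> k"
        using B[of "Suc k"] mono[of k] by (intro mult_right_mono) auto
      moreover have "cf_den \<alpha> (Suc k) = partial_quotient \<alpha> (Suc k) * cf_den \<alpha> k + cf_den \<alpha> j"
        by (simp add: Suc)
      ultimately show ?thesis using mono[of j] unfolding Suc distrib_right by linarith
    qed
    then show "cf_den \<alpha> (Suc k) \<le> (of_int B + 1) * real_of_int (cf_den \<alpha> k)"
      by (metis (no_types, opaque_lifting) of_int_1 of_int_add of_int_le_iff of_int_mult)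
  qed auto
  then show thesis by (rule that)
qed

section \<open>Growth of the denominators and a Diophantine criterion for bounded type\<close>

context convergents
begin

lemma q_pos': "0 < real_of_int (q k)" "0 < q k"
  using q_pos[of k] by simp_all

lemma q_mono: "i \<le> j \<Longrightarrow> q i \<le> q j"
  by (rule lift_Suc_mono_le[of q]) (auto simp: q_Suc_ge)

lemma q_double: "2 * q k \<le> q (Suc (Suc k))"
proof -
  have "q k \<le> a k * q (Suc k)"
    using mult_mono[OF a_ge[of k] q_Suc_ge[of k]] q_pos[of k] a_ge[of k] by simp
  then show ?thesis by (simp add: q_rec)
qed

text \<open>Index 0 is excluded since \<open>q 0 = q 1\<close> can occur.\<close>

lemma q_strict:
  assumes "i < j" "1 \<le> i" shows "q i < q j"
proof -
  obtain m where m: "i = Suc m" using assms(2) by (cases i) auto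
  have "q i \<le> a m * q i" using a_ge[of m] q_pos[of i] by simp
  then have "q i < q (Suc i)" using q_rec[of m] q_pos[of m] m by simp
  also have "\<dots> \<le> q j" using assms by (intro q_mono) simp
  finally show ?thesis .
qed

text \<open>The denominators double every two steps, and the square of 4/3 is below 2. The factor 2
  on the right absorbs the start at m = 1.\<close>

lemma q_growth: "(4/3) ^ m * real_of_int (q k) \<le> 2 * q (k + m)"
proof (induction m rule: induct_nat_012)
  case 0 then show ?case using q_pos[of k] by simp
next
  case 1
  then show ?case using q_pos[of k] q_Suc_ge[of k] by simp
next
  case (ge2 m)
  have "2 * real_of_int (q (k + m)) \<le> q (k + Suc (Suc m))"
    using q_double[of "k + m"] of_int_le_iff[of "2 * q (k+m)"] by simp
  moreover have "0 \<le> (4/3) ^ m * real_of_int (q k)" using q_pos'(1)[of k] by simp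
  then have "(4/3) ^ Suc (Suc m) * real_of_int (q k) \<le> 2 * ((4/3) ^ m * real_of_int (q k))"
    by (simp only: power_Suc)
  ultimately show ?case using ge2(1) by linarith
qed

lemma A_ge_1: "1 \<le> A"
  using a_ge[of 0] a_le[of 0] by linarith

text \<open>For large k the failure of \<open>r\<close> to satisfy the recurrence is an integer of
  modulus below 1, hence zero. So \<open>r\<close> is eventually an integer combination m p + n q,
  and q (\<beta> - m \<alpha> - n) stays bounded while q tends to infinity.\<close>

lemma bounded_type_characterization:
  fixes \<beta> :: real
  assumes lim: "(\<lambda>k. q k * \<beta> - of_int (r k)) \<longlonglongrightarrow> 0"
  shows "\<exists>m n :: int. \<beta> = of_int m * \<alpha> + of_int n"
proof -
  define \<theta> where "\<theta> k = q k * \<beta> - of_int (r k)" for k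
  \<comment> \<open>Three consecutive errors enter the recurrence with weights 1, at most A, and 1;
    their total A + 2 fixes the tolerance.\<close>
  have "eventually (\<lambda>k. \<bar>\<theta> k\<bar> < 1 / (A + 2)) sequentially"
    using tendstoD[OF lim, of "1 / (A + 2)"] A_ge_1 by (simp add: \<theta>_def)
  then obtain K where K: "\<And>k. k \<ge> K \<Longrightarrow> \<bar>\<theta> k\<bar> < 1 / (A + 2)"
    unfolding eventually_sequentially by blast
  have r_rec: "r (Suc (Suc k)) = a k * r (Suc k) + r k" if "k \<ge> K" for k
  proof -
    have "real_of_int (a k * r (Suc k) + r k - r (Suc (Suc k)))
        = \<theta> (Suc (Suc k)) - a k * \<theta> (Suc k) - \<theta> k"
      unfolding \<theta>_def by (simp add: q_rec algebra_simps)
    also have "\<bar>\<dots>\<bar> \<le> \<bar>\<theta> (Suc (Suc k))\<bar> + \<bar>a k * \<theta> (Suc k)\<bar> + \<bar>\<theta> k\<bar>" by linarith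
    also have "\<bar>a k * \<theta> (Suc k)\<bar> \<le> A * (1 / (A + 2))"
      unfolding abs_mult using K[of "Suc k"] that a_ge[of k] a_le[of k] A_ge_1
      by (intro mult_mono) auto
    also have "\<bar>\<theta> (Suc (Suc k))\<bar> + A * (1 / (A + 2)) + \<bar>\<theta> k\<bar> <
        1 / (A + 2) + A * (1 / (A + 2)) + 1 / (A + 2)"
      using K[of k] K[of "Suc (Suc k)"] that by simp
    also have "\<dots> = 1" using A_ge_1 by (simp add: add_divide_distrib[symmetric])
    finally have "\<bar>a k * r (Suc k) + r k - r (Suc (Suc k))\<bar> < 1" by linarith
    then show ?thesis by simp
  qed
  \<comment> \<open>The determinant is 1 or -1, so it is its own inverse and Cramer's rule yields
    integers m and n.\<close>
  define s where "s = q (Suc K) * p K - q K * p (Suc K)"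
  have s: "s * s = 1" using det[of K] unfolding s_def[symmetric] by (metis abs_mult_self_eq mult_1)
  define m where "m = s * (q (Suc K) * r K - q K * r (Suc K))"
  define n where "n = s * (p K * r (Suc K) - p (Suc K) * r K)"
  have init: "r K = m * p K + n * q K" "r (Suc K) = m * p (Suc K) + n * q (Suc K)"
  proof -
    have "m * p K + n * q K = s * s * r K" unfolding m_def n_def s_def by algebra
    then show "r K = m * p K + n * q K" by (simp add: s)
    have "m * p (Suc K) + n * q (Suc K) = s * s * r (Suc K)" unfolding m_def n_def s_def by algebra
    then show "r (Suc K) = m * p (Suc K) + n * q (Suc K)" by (simp add: s)
  qed
  have r: "r (K + i) = m * p (K + i) + n * q (K + i)" for i
  proof (induction i rule: induct_nat_012)
    case (ge2 i)
    then show ?case using r_rec[of "K + i"] by (simp add: q_rec p_rec algebra_simps)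
  qed (use init in auto)
  define \<gamma> where "\<gamma> = \<beta> - (m * \<alpha> + n)"
  have bound: "q (K + i) * \<bar>\<gamma>\<bar> \<le> \<bar>\<theta> (K + i)\<bar> + \<bar>real_of_int m\<bar>" for i
  proof -
    have "q (K + i) * \<gamma> = \<theta> (K + i) - m * (q (K + i) * \<alpha> - p (K + i))"
      unfolding \<gamma>_def \<theta>_def r by (simp add: algebra_simps)
    then have "q (K + i) * \<bar>\<gamma>\<bar> \<le> \<bar>\<theta> (K + i)\<bar> + \<bar>real_of_int m\<bar> * \<bar>q (K + i) * \<alpha> - p (K + i)\<bar>"
      using q_pos'(1)[of "K + i"]
        abs_triangle_ineq4[of "\<theta> (K + i)" "m * (q (K + i) * \<alpha> - p (K + i))"]
        abs_mult[of "q (K + i)" \<gamma>] abs_mult[of m "q (K + i) * \<alpha> - p (K + i)"] by simp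
    also have "\<bar>q (K + i) * \<alpha> - p (K + i)\<bar> \<le> 1"
      using D_le[of "K + i"] q_pos[of "Suc (K + i)"]
      by (smt (verit) divide_le_eq_1 of_int_1_le_iff)
    finally show ?thesis by (simp add: mult_left_le mult_left_mono)
  qed
  have "\<gamma> = 0"
  proof (rule ccontr)
    assume "\<gamma> \<noteq> 0"
    define c where "c = 2 * (1 / (A + 2) + \<bar>real_of_int m\<bar>) / \<bar>\<gamma>\<bar>"
    obtain i where i: "c < (4/3) ^ i" using real_arch_pow[of "4/3" c] by auto
    have "(4/3) ^ i * 1 \<le> (4/3) ^ i * real_of_int (q K)" using q_pos[of K] by (intro mult_left_mono) auto
    also have "\<dots> \<le> 2 * q (K + i)" by (rule q_growth)
    finally have "c * \<bar>\<gamma>\<bar> < 2 * q (K + i) * \<bar>\<gamma>\<bar>" using i \<open>\<gamma> \<noteq> 0\<close> by simp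
    moreover have "c * \<bar>\<gamma>\<bar> = 2 * (1 / (A + 2) + \<bar>real_of_int m\<bar>)" using \<open>\<gamma> \<noteq> 0\<close> by (simp add: c_def)
    ultimately show False using bound[of i] K[of "K + i"] by simp
  qed
  then show ?thesis unfolding \<gamma>_def by (intro exI[of _ m] exI[of _ n]) simp
qed

end

section \<open>Measurable functions on the circle\<close>

lemma space_circle [simp]: "space circle = {0..<1}"
  by (simp add: circle_def)

text \<open>Completion does not change which properties hold almost everywhere, so one can work with
  \<open>lborel\<close>, where translation invariance is at hand.\<close>

lemma AE_circle_iff: "(AE x in circle. P x) \<longleftrightarrow> (AE x in lborel. x \<in> {0..<1} \<longrightarrow> P x)"
  unfolding circle_def by (subst AE_restrict_space_iff) (auto simp: AE_completion_iff)

lemma AE_lborel_translate: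
  assumes "AE x in lborel. P x" shows "AE x in lborel. P (x + t :: real)"
proof -
  have "AE x in distr lborel borel ((+) t). P x" using assms by (subst lborel_distr_plus)
  from AE_distrD[OF _ this] show ?thesis by (simp add: add.commute)
qed

text \<open>The line is covered by countably many integer translates of the unit interval, and a
  countable union of null sets is null.\<close>

lemma AE_circle_imp_AE_frac:
  assumes "AE x in circle. P x" shows "AE x in lborel. P (frac x)"
proof -
  have "AE x in lborel. \<forall>n::int. x + of_int n \<in> {0..<1} \<longrightarrow> P (x + of_int n)"
    unfolding AE_all_countable using AE_lborel_translate assms[unfolded AE_circle_iff] by blast
  then show ?thesis
  proof eventually_elim
    case (elim x)
    show ?case
      using elim[rule_format, of "- \<lfloor>x\<rfloor>"] frac_lt_1[of x] frac_ge_0[of x] by (simp add: frac_def)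
  qed
qed

lemma AE_frac_imp_AE_circle:
  assumes "AE x in lborel. P (frac x)" shows "AE x in circle. P x"
  unfolding AE_circle_iff using assms by eventually_elim (metis atLeastLessThan_iff frac_eq)

text \<open>A change on a null set makes \<open>g\<close> Borel, and composing with
  \<open>frac\<close> extends it periodically, so that rotations become translations of the
  line.\<close>

lemma circle_borel_representative:
  assumes "g \<in> borel_measurable circle"
  obtains G :: "real \<Rightarrow> real"
  where "G \<in> borel_measurable borel" "\<And>x. G (frac x) = G x" "AE x in circle. G x = g x"
proof -
  have "(\<lambda>x. if x \<in> {0..<1} then g x else 0) \<in> borel_measurable lebesgue"
    using assms unfolding circle_def by (rule borel_measurable_if_I) simp
  then obtain g' where g': "g' \<in> borel_measurable lborel"
      "AE x in lborel. (if x \<in> {0..<1} then g x else 0) = g' x"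
    using completion_ex_borel_measurable_real by blast
  have "(\<lambda>x. g' (frac x)) \<in> borel_measurable borel"
    using g'(1) unfolding frac_def by measurable
  moreover have "AE x in circle. g' (frac x) = g x"
    unfolding AE_circle_iff using g'(2) by eventually_elim (metis atLeastLessThan_iff frac_eq)
  ultimately show thesis by (intro that[of "\<lambda>x. g' (frac x)"]) auto
qed

section \<open>Ergodicity of irrational rotations\<close>

lemma Z_module_dense:
  fixes \<alpha> x :: real
  assumes "\<alpha> \<notin> \<rat>" "\<epsilon> > 0"
  obtains m n :: int where "\<bar>x - (of_int m * \<alpha> + of_int n)\<bar> < \<epsilon>"
proof -
  obtain h k where "\<bar>of_int k * \<alpha> - of_int h - x\<bar> < \<epsilon>"
    using sequence_of_fractional_parts_is_dense[OF assms] by metis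
  then show thesis by (intro that[of k "- h"]) (simp add: abs_minus_commute)
qed

text \<open>An interval average of a function with dense group of periods does not depend on the
  position of the interval, which makes the indefinite integral linear.\<close>

lemma two_periods_imp_constant:
  fixes H :: "real \<Rightarrow> real"
  assumes [measurable]: "H \<in> borel_measurable borel"
    and H: "\<And>x. 1 \<le> H x" "\<And>x. H x \<le> B"
    and per: "\<And>x. H (x + 1) = H x" and inv: "AE x in lborel. H (x + \<alpha>) = H x"
    and irr: "\<alpha> \<notin> \<rat>"
  shows "\<exists>c. AE x in lborel. H x = c"
proof -
  define I where "I a w = integral {a..a + w} H" for a w
  have int: "H integrable_on {a..b}" for a b
  proof (rule measurable_bounded_by_integrable_imp_integrable)
    show "H \<in> borel_measurable (lebesgue_on {a..b})"
      by (intro measurable_restrict_space1 measurable_completion) simp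
    show "(\<lambda>x. B) integrable_on {a..b}"
      by (intro integrable_continuous_interval continuous_on_const)
    show "norm (H x) \<le> B" for x using H[of x] by simp
  qed simp
  have I_bounds: "w \<le> I a w" "I a w \<le> B * w" if "w \<ge> 0" for a w
  proof -
    have "integral {a..a+w} (\<lambda>x. 1) \<le> I a w" unfolding I_def
      by (intro integral_le int) (use H in auto)
    then show "w \<le> I a w" using that by simp
    have "I a w \<le> integral {a..a+w} (\<lambda>x. B)" unfolding I_def
      by (intro integral_le int) (use H in auto)
    then show "I a w \<le> B * w" using that by (simp add: mult.commute)
  qed
  have I_add: "I a (v + w) = I a v + I (a + v) w" if "v \<ge> 0" "w \<ge> 0" for a v w
    unfolding I_def
    using Henstock_Kurzweil_Integration.integral_combine[of a "a + v" "a + v + w" H] that int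
    by (simp add: add.assoc)
  \<comment> \<open>Almost everywhere periods form a group; it contains \<alpha> and 1, hence the
    dense set \<int>\<alpha> + \<int>.\<close>
  define is_period where "is_period t \<longleftrightarrow> (AE x in lborel. H (x + t) = H x)" for t
  have period_I: "I (a + t) w = I a w" if t: "is_period t" for a t w
  proof -
    obtain N where N: "N \<in> null_sets lborel" "{x. H (x + t) \<noteq> H x} \<subseteq> N"
      using t unfolding is_period_def eventually_ae_filter by auto
    then have "negligible N" by (simp add: negligible_iff_null_sets null_sets_completionI)
    have "I (a + t) w = integral {a..a+w} (\<lambda>x. H (x + t))"
    proof -
      have "(H has_integral I (a + t) w) (cbox (a + t) (a + t + w))"
        unfolding I_def using int integrable_integral by auto
      from has_integral_affinity'[OF this, of 1 t]
      have "((\<lambda>x. H (x + t)) has_integral I (a + t) w) {a..a+w}" by (simp add: algebra_simps)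
      then show ?thesis by (simp add: integral_unique)
    qed
    also have "\<dots> = I a w" unfolding I_def
      by (rule integral_spike[OF \<open>negligible N\<close>]) (use N(2) in force)
    finally show ?thesis .
  qed
  have period_add: "is_period (s + t)" if "is_period s" "is_period t" for s t
    using AE_lborel_translate[of "\<lambda>x. H (x + t) = H x" s] that unfolding is_period_def
    by (auto elim!: eventually_elim2 simp: add.assoc)
  have period_uminus: "is_period (- t)" if "is_period t" for t
    using AE_lborel_translate[of "\<lambda>x. H (x + t) = H x" "- t"] that unfolding is_period_def
    by (auto elim: eventually_mono)
  have period_int: "is_period (of_int n * t)" if "is_period t" for n t
  proof (induction n rule: int_induct[of _ 0])
    case base then show ?case by (simp add: is_period_def)
  next
    case (step1 i)
    then show ?case using period_add that by (simp add: distrib_right)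
  next
    case (step2 i)
    then show ?case using period_add[OF _ period_uminus[OF that], of "of_int i * t"] by (simp add: left_diff_distrib)
  qed
  have period: "is_period (of_int m * \<alpha> + of_int n)" for m n
    using period_add[OF period_int[of \<alpha> m] period_int[of 1 n]] per inv by (simp add: is_period_def)
  \<comment> \<open>Sliding the window by e exchanges one piece of length e for another, and both
    have integrals between e and B e.\<close>
  have I_shift: "\<bar>I (a + e) w - I a w\<bar> \<le> B * e" if "w \<ge> 0" "e \<ge> 0" for a e w
  proof -
    have "I a e + I (a + e) w = I a w + I (a + w) e"
      using I_add[OF that(2,1), of a] I_add[OF that, of a] by (simp add: add.commute)
    then show ?thesis using I_bounds[OF that(2), of a] I_bounds[OF that(2), of "a + w"] that by linarith
  qed
  have I_const: "I a w = I 0 w" if w: "w \<ge> 0" for a w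
  proof -
    have B: "B \<ge> 1" using H[of 0] by linarith
    have "\<bar>I a w - I 0 w\<bar> \<le> 0 + e" if "e > 0" for e
    proof -
      obtain m n :: int where mn: "\<bar>a - (of_int m * \<alpha> + of_int n)\<bar> < e / B"
        using Z_module_dense[OF irr, of "e / B" a] \<open>e > 0\<close> B by auto
      define t where "t = of_int m * \<alpha> + of_int n"
      have "I t w = I 0 w" using period_I[OF period[of m n], of 0] by (simp add: t_def)
      moreover have "\<bar>I a w - I t w\<bar> \<le> B * \<bar>a - t\<bar>"
        using I_shift[of w "a - t" t] I_shift[of w "t - a" a] w by (cases "t \<le> a") auto
      moreover have "B * \<bar>a - t\<bar> \<le> e" using mn B by (simp add: t_def field_simps)
      ultimately show ?thesis by linarith
    qed
    then show ?thesis using field_le_epsilon[of "\<bar>I a w - I 0 w\<bar>" 0] by simp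
  qed
  define c where "c = I 0 1"
  have "c \<ge> 1" using I_bounds[of 1 0] by (simp add: c_def)
  have add0: "I 0 (v + w) = I 0 v + I 0 w" if "v \<ge> 0" "w \<ge> 0" for v w
    using I_add[OF that, of 0] I_const[OF that(2), of v] by simp
  have mono0: "I 0 v \<le> I 0 w" if "0 \<le> v" "v \<le> w" for v w
    using add0[of v "w - v"] I_bounds[of "w - v" 0] that by simp
  have mult0: "I 0 (real n * w) = real n * I 0 w" if "w \<ge> 0" for n w
  proof (induction n)
    case 0 then show ?case by (simp add: I_def)
  next
    case (Suc n)
    then show ?case using add0[of w "real n * w"] that by (simp add: distrib_right)
  qed
  \<comment> \<open>Additivity and monotonicity suffice: with k the integer part of n w, both n
    \<open>I 0 w\<close> and n c w lie between k c and (k + 1) c, so their difference stays bounded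
    as n grows.\<close>
  have lin: "I 0 w = c * w" if w: "w \<ge> 0" for w
  proof -
    have bd: "real n * \<bar>I 0 w - c * w\<bar> \<le> c" for n
    proof -
      define k where "k = nat \<lfloor>real n * w\<rfloor>"
      have k: "real k \<le> real n * w" "real n * w \<le> real (Suc k)" using w real_of_int_floor_add_one_ge[of "real n * w"]
        by (auto simp: k_def add.commute)
      have "real k * c \<le> real n * I 0 w"
        using mono0[OF _ k(1)] mult0[of 1 k] mult0[OF w, of n] by (simp add: c_def)
      moreover have "real n * I 0 w \<le> real (Suc k) * c"
        using mono0[OF _ k(2)] mult0[of 1 "Suc k"] mult0[OF w, of n] w by (simp add: c_def)
      moreover have "real k * c \<le> real n * (c * w)"
        using mult_right_mono[OF k(1), of c] \<open>c \<ge> 1\<close> by (simp add: ac_simps)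
      moreover have "real n * (c * w) \<le> real (Suc k) * c"
        using mult_right_mono[OF k(2), of c] \<open>c \<ge> 1\<close> by (simp add: ac_simps)
      ultimately have "\<bar>real n * I 0 w - real n * (c * w)\<bar> \<le> c"
        by (simp add: distrib_right abs_le_iff)
      then show ?thesis by (simp add: right_diff_distrib[symmetric] abs_mult)
    qed
    show ?thesis
    proof (rule ccontr)
      assume "I 0 w \<noteq> c * w"
      then obtain n where "c < real n * \<bar>I 0 w - c * w\<bar>"
        using reals_Archimedean3[of "\<bar>I 0 w - c * w\<bar>"] by auto
      then show False using bd[of n] by simp
    qed
  qed
  have Hc: "0 \<le> H x / c" for x using order_trans[OF zero_le_one H(1)[of x]] \<open>c \<ge> 1\<close> by simp
  define M where "M = density lborel (\<lambda>x. ennreal (H x / c))"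
  \<comment> \<open>The density H / c gives every interval its length, so it defines Lebesgue
    measure; uniqueness of densities then makes it 1 almost everywhere.\<close>
  have "lborel = M"
  proof (rule lborel_eqI)
    fix l u :: real assume "\<And>b. b \<in> Basis \<Longrightarrow> l \<bullet> b \<le> u \<bullet> b"
    then have lu: "l \<le> u" by simp
    have "((\<lambda>x. H x / c) has_integral (I l (u - l) / c)) {l..u}"
      using int[of l u] unfolding I_def by (intro has_integral_divide) (simp add: has_integral_integral)
    moreover have "I l (u - l) / c = u - l"
      using lin[of "u - l"] I_const[of "u - l" l] lu \<open>c \<ge> 1\<close> by simp
    ultimately have "((\<lambda>x. H x / c) has_integral (u - l)) {l..u}" by simp
    then have "((\<lambda>x. if x \<in> {l..u} then H x / c else 0) has_integral (u - l)) UNIV"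
      by (simp only: has_integral_restrict_UNIV)
    then have "(\<integral>\<^sup>+x. ennreal (if x \<in> {l..u} then H x / c else 0) \<partial>lborel) = ennreal (u - l)"
      by (intro nn_integral_has_integral_lborel) (auto simp: Hc)
    also have "(\<integral>\<^sup>+x. ennreal (if x \<in> {l..u} then H x / c else 0) \<partial>lborel)
       = (\<integral>\<^sup>+x. ennreal (H x / c) * indicator (box l u) x \<partial>lborel)"
    proof (rule nn_integral_cong_AE)
      have "AE x in lborel. x \<noteq> l \<and> x \<noteq> u"
        using AE_lborel_singleton[of l] AE_lborel_singleton[of u] by eventually_elim simp
      then show "AE x in lborel. ennreal (if x \<in> {l..u} then H x / c else 0) =
          ennreal (H x / c) * indicator (box l u) x"
        by eventually_elim (auto simp: indicator_def)
    qed
    finally show "emeasure M (box l u) = (\<Prod>b\<in>Basis. (u - l) \<bullet> b)"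
      by (simp add: M_def emeasure_density)
  qed (simp add: M_def)
  then have "density lborel (\<lambda>x. ennreal (H x / c)) = density lborel (\<lambda>x. 1)"
    by (simp add: M_def density_1)
  then have "AE x in lborel. ennreal (H x / c) = 1"
    by (subst (asm) sigma_finite_measure.density_unique_iff[OF sigma_finite_lborel]) auto
  then have "AE x in lborel. H x = c"
  proof eventually_elim
    case (elim x)
    then show ?case using \<open>c \<ge> 1\<close> H(1)[of x] by (simp add: ennreal_eq_1)
  qed
  then show ?thesis by blast
qed

text \<open>An arbitrary measurable function is first made bounded and positive:
  \<open>arctan\<close> takes values in (-2, 2), so adding 3 lands in [1, 5]. The tangent recovers
  the constant.\<close>

lemma rotation_ergodic:
  assumes g: "g \<in> borel_measurable circle" and irr: "\<alpha> \<notin> \<rat>"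
    and inv: "AE x in circle. g (rotation \<alpha> x) = g x"
  shows "\<exists>c::real. AE x in circle. g x = c"
proof -
  obtain G :: "real \<Rightarrow> real" where G: "G \<in> borel_measurable borel" "\<And>x. G (frac x) = G x" "AE x in circle. G x = g x"
    using circle_borel_representative[OF g] by blast
  define H where "H x = arctan (G x) + 3" for x
  have Gg: "AE x in lborel. G x = g (frac x)"
    using AE_circle_imp_AE_frac[OF G(3)] by (simp add: G(2))
  have fr: "frac (frac x + \<alpha>) = frac (x + \<alpha>)" for x by simp
  have inv': "AE x in lborel. G (x + \<alpha>) = G x"
    using AE_circle_imp_AE_frac[OF inv] Gg AE_lborel_translate[OF Gg, of \<alpha>]
    by eventually_elim (simp add: rotation_def)
  have "\<exists>c. AE x in lborel. H x = c"
  proof (rule two_periods_imp_constant)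
    show "H \<in> borel_measurable borel" using G(1) unfolding H_def by measurable
    show "1 \<le> H x" "H x \<le> 5" for x
      using arctan_lbound[of "G x"] arctan_ubound[of "G x"] pi_less_4 by (auto simp: H_def)
    show "H (x + 1) = H x" for x using G(2)[of x] G(2)[of "x + 1"] by (simp add: H_def frac_1_eq)
    show "AE x in lborel. H (x + \<alpha>) = H x" using inv' by eventually_elim (simp add: H_def)
  qed (rule irr)
  then obtain c where c: "AE x in lborel. H x = c" by blast
  have "AE x in lborel. G x = tan (c - 3)"
    using c by eventually_elim (auto simp: H_def tan_arctan)
  then have "AE x in lborel. g (frac x) = tan (c - 3)" using Gg by eventually_elim simp
  then show ?thesis using AE_frac_imp_AE_circle[of "\<lambda>x. g x = tan (c - 3)"] by blast
qed


text \<open>The sets where |G| exceeds n decrease to the empty set inside [0, 2]. By periodicity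
  every unit window can be moved into [0, 2], which makes the bound uniform in t.\<close>

lemma periodic_tight:
  fixes G :: "real \<Rightarrow> real"
  assumes [measurable]: "G \<in> borel_measurable borel"
    and per: "\<And>x. G (frac x) = G x" and "\<delta> > 0"
  obtains M where "M > 0" "\<And>t. measure lborel {x \<in> {0..1}. M < \<bar>G (x + t)\<bar>} \<le> \<delta>"
proof -
  define E where "E M = {y \<in> {0..2}. M < \<bar>G y\<bar>}" for M :: real
  have [measurable]: "E M \<in> sets borel" for M unfolding E_def by measurable
  have fin: "emeasure lborel (E M) \<noteq> \<infinity>" for M
  proof -
    have "emeasure lborel (E M) \<le> emeasure lborel {0..2::real}"
      by (rule emeasure_mono) (auto simp: E_def)
    then show ?thesis by (auto simp: top_unique)
  qed
  have "(\<lambda>n. measure lborel (E (real n))) \<longlonglongrightarrow> measure lborel (\<Inter>n. E (real n))"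
    by (rule Lim_measure_decseq) (use fin in \<open>auto simp: decseq_def E_def\<close>)
  moreover have "(\<Inter>n. E (real n)) = {}"
  proof -
    have "\<exists>n. \<not> real n < \<bar>G y\<bar>" for y using real_arch_simple[of "\<bar>G y\<bar>"] by (auto simp: not_less)
    then show ?thesis by (auto simp: E_def)
  qed
  ultimately have "eventually (\<lambda>n. measure lborel (E (real n)) < \<delta>) sequentially"
    using order_tendstoD(2)[of "\<lambda>n. measure lborel (E (real n))" 0] \<open>\<delta> > 0\<close> by simp
  then obtain n where n: "measure lborel (E (real (Suc n))) < \<delta>"
    unfolding eventually_sequentially by (meson le_SucI le_refl)
  show thesis
  proof
    show "0 < real (Suc n)" by simp
    fix t
    let ?M = "real (Suc n)"
    have shift: "G (x + t) = G (x + frac t)" for x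
      using per[of "x + t"] per[of "x + frac t"] by simp
    have "{x \<in> {0..1}. ?M < \<bar>G (x + t)\<bar>} \<subseteq> (+) (frac t) -` E ?M"
      using frac_ge_0[of t] frac_lt_1[of t] by (auto simp: E_def shift add.commute)
    moreover have eq: "emeasure lborel ((+) (frac t) -` E ?M) = emeasure lborel (E ?M)"
      using emeasure_distr[of "(+) (frac t)" lborel borel "E ?M"] by (simp add: lborel_distr_plus)
    have "(+) (frac t) -` E ?M \<in> sets borel"
      using measurable_sets[of "(+) (frac t)" borel borel "E ?M"] by simp
    ultimately have "measure lborel {x \<in> {0..1}. ?M < \<bar>G (x + t)\<bar>} \<le> measure lborel ((+) (frac t) -` E ?M)"
      using fin[of ?M] eq by (intro measure_mono_fmeasurable fmeasurableI) (auto simp: less_top)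
    also have "\<dots> \<le> \<delta>" using n eq by (simp add: measure_def)
    finally show "measure lborel {x \<in> {0..1}. ?M < \<bar>G (x + t)\<bar>} \<le> \<delta>" .
  qed
qed

text \<open>This turns boundedness in probability into a bound on a Fourier coefficient: K is the
  bound off the exceptional set, S the crude bound paid on it.\<close>

lemma has_integral_bound_off_small_set:
  fixes f :: "real \<Rightarrow> real"
  assumes f: "(f has_integral I) {0..1}" and E: "E \<in> sets borel" "E \<subseteq> {0..1}"
    and S: "\<And>x. x \<in> {0..1} \<Longrightarrow> \<bar>f x\<bar> \<le> S"
    and K: "\<And>x. x \<in> {0..1} - E \<Longrightarrow> \<bar>f x\<bar> \<le> K" "0 \<le> K"
  shows "\<bar>I\<bar> \<le> K + S * measure lborel E"
proof -
  have "emeasure lborel E < \<infinity>"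
    using emeasure_mono[OF E(2), of lborel] by (auto simp: less_top[symmetric] top_unique)
  from has_integral_measure_lborel[OF E(1) this]
  have "((\<lambda>x. if x \<in> E then 1 else 0) has_integral measure lborel E) {0..1}"
    by (simp only: has_integral_restrict[OF E(2)])
  then have "((\<lambda>x. S * indicator E x) has_integral S * measure lborel E) {0..1}"
    by (intro has_integral_mult_right) (simp add: indicator_def of_bool_def)
  then have b: "((\<lambda>x. K + S * indicator E x) has_integral (K + S * measure lborel E)) {0..1}"
    using has_integral_add[OF has_integral_const_real[of K 0 1]] by fastforce
  have "norm (integral {0..1} f) \<le> integral {0..1} (\<lambda>x. K + S * indicator E x)"
    using f b S K E(2) order_trans[OF abs_ge_zero S]
    by (intro integral_norm_bound_integral) (auto simp: indicator_def intro: order_trans[OF S])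
  then show ?thesis using f b by (simp add: integral_unique)
qed

section \<open>Trigonometric series\<close>

lemma concave_on_sin: "concave_on {0..pi} sin"
  by (rule f''_le0_imp_concave[where f'=cos and f''="\<lambda>x. - sin x"])
    (auto intro!: derivative_eq_intros sin_ge_zero)

text \<open>By concavity the sine lies above its chord from 0 to \<pi>/2.\<close>

lemma abs_sin_pi_ge:
  assumes "\<bar>y\<bar> \<le> 1 / 2" shows "2 * \<bar>y\<bar> \<le> \<bar>sin (pi * y)\<bar>"
proof -
  have "2 * t \<le> sin (pi * t)" if "0 \<le> t" "t \<le> 1 / 2" for t
    using concave_onD[OF concave_on_sin, of "2 * t" 0 "pi / 2"] that by (simp add: mult.commute)
  from this[of "\<bar>y\<bar>"] assms show ?thesis
    by (cases "y \<ge> 0") (simp_all add: abs_if)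
qed

lemma abs_sin_pi_le: "\<bar>sin (pi * y)\<bar> \<le> pi * \<bar>y\<bar>"
  using abs_sin_x_le_abs_x[of "pi * y"] by (simp add: abs_mult)

lemma abs_sin_pi_diff_int: "\<bar>sin (pi * (y - of_int m))\<bar> = \<bar>sin (pi * y)\<bar>"
proof -
  have "sin (pi * of_int m) = 0" by (simp add: mult.commute)
  moreover from this have "\<bar>cos (pi * of_int m)\<bar> = 1" by (rule sin_zero_abs_cos_one)
  ultimately show ?thesis by (simp only: right_diff_distrib sin_diff abs_mult) simp
qed

text \<open>The factor \<open>sin z\<close> makes each term a difference of cosines, so the sum
  telescopes, and it avoids a case distinction on the zeros of \<open>sin z\<close>.\<close>

lemma sum_sin_progression:
  "(\<Sum>i<n. sin (y + 2 * real i * z)) * sin z = sin (real n * z) * sin (y + (real n - 1) * z)"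
proof -
  have "(\<Sum>i<n. sin (y + 2 * real i * z)) * sin z = (cos (y - z) - cos (y + (2 * real n - 1) * z)) / 2"
  proof (induction n)
    case (Suc n)
    have "sin (y + 2 * real n * z) * sin z =
        (cos (y + (2 * real n - 1) * z) - cos (y + (2 * real (Suc n) - 1) * z)) / 2"
      unfolding sin_times_sin by (simp add: algebra_simps)
    then show ?case using Suc by (simp add: distrib_right)
  qed simp
  also have "\<dots> = sin (real n * z) * sin (y + (real n - 1) * z)"
    unfolding sin_times_sin using cos_minus[of "y - z"] by (simp add: algebra_simps)
  finally show ?thesis .
qed

lemma has_integral_cos_period:
  fixes K :: int
  assumes "K \<noteq> 0"
  shows "((\<lambda>x. cos (2 * pi * K * x + \<phi>)) has_integral 0) {0..1}"
proof -
  have "((\<lambda>x. cos (2 * pi * K * x + \<phi>)) has_integral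
      (sin (2 * pi * K * 1 + \<phi>) / (2 * pi * K) - sin (2 * pi * K * 0 + \<phi>) / (2 * pi * K))) {0..1}"
    by (rule fundamental_theorem_of_calculus)
      (use assms in \<open>auto intro!: derivative_eq_intros simp flip: has_real_derivative_iff_has_vector_derivative\<close>)
  moreover have "sin (2 * pi * real_of_int K + \<phi>) = sin \<phi>" by (simp add: sin_add)
  ultimately show ?thesis by simp
qed

lemma sin_orthogonality:
  fixes M N :: int
  assumes "0 < M" "0 < N" "M \<noteq> N \<or> \<phi> = \<psi>"
  shows "((\<lambda>x. sin (2 * pi * M * x + \<phi>) * sin (2 * pi * N * x + \<psi>))
    has_integral (if M = N then 1 / 2 else 0)) {0..1}"
proof -
  have eq: "sin (2 * pi * M * x + \<phi>) * sin (2 * pi * N * x + \<psi>) =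
      (cos (2 * pi * (M - N) * x + (\<phi> - \<psi>)) - cos (2 * pi * (M + N) * x + (\<phi> + \<psi>))) / 2" for x :: real
    unfolding sin_times_sin by (simp add: algebra_simps)
  have 1: "((\<lambda>x. cos (2 * pi * (M + N) * x + (\<phi> + \<psi>))) has_integral 0) {0..1}"
    using has_integral_cos_period[of "M + N"] assms by simp
  have 2: "((\<lambda>x. cos (2 * pi * (M - N) * x + (\<phi> - \<psi>))) has_integral (if M = N then 1 else 0)) {0..1}"
  proof (cases "M = N")
    case True
    then show ?thesis using assms has_integral_const_real[of "1::real" 0 1] by simp
  next
    case False
    then show ?thesis using has_integral_cos_period[of "M - N"] by simp
  qed
  have "((\<lambda>x. (cos (2 * pi * (M - N) * x + (\<phi> - \<psi>)) - cos (2 * pi * (M + N) * x + (\<phi> + \<psi>))) / 2)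
      has_integral (((if M = N then 1 else 0) - 0) / 2)) {0..1}"
    by (intro has_integral_divide has_integral_diff 1 2)
  then show ?thesis unfolding eq by (simp split: if_splits)
qed

text \<open>Absolute summability gives uniform convergence, hence termwise integration, and
  orthogonality keeps only mode j. Repeated frequencies are tolerated where the coefficient
  vanishes, which covers a possible \<open>q 0 = q 1\<close>.\<close>

lemma has_integral_sine_coefficient:
  fixes c \<phi> :: "nat \<Rightarrow> real" and q :: "nat \<Rightarrow> int"
  assumes sum: "summable (\<lambda>k. \<bar>c k\<bar>)" and pos: "\<And>k. 0 < q k"
    and inj: "\<And>k. k \<noteq> j \<Longrightarrow> c k \<noteq> 0 \<Longrightarrow> q k \<noteq> q j"
  shows "((\<lambda>x. (\<Sum>k. c k * sin (2 * pi * q k * x + \<phi> k)) * sin (2 * pi * q j * x + \<phi> j))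
    has_integral c j / 2) {0..1}"
proof -
  define f where "f k x = c k * sin (2 * pi * q k * x + \<phi> k) * sin (2 * pi * q j * x + \<phi> j)" for k x
  have f: "(f k has_integral (if k = j then c j / 2 else 0)) {0..1}" for k
  proof (cases "k = j \<or> c k \<noteq> 0")
    case True
    then have "((\<lambda>x. sin (2 * pi * q k * x + \<phi> k) * sin (2 * pi * q j * x + \<phi> j))
        has_integral (if q k = q j then 1 / 2 else 0)) {0..1}"
      using inj[of k] by (intro sin_orthogonality pos) auto
    from has_integral_mult_right[OF this, of "c k"] True inj[of k]
    show ?thesis unfolding f_def by (auto simp: mult.assoc split: if_splits)
  next
    case False
    then show ?thesis unfolding f_def by simp
  qed
  have sin1: "\<bar>sin x * sin y\<bar> \<le> 1" for x y :: real
    unfolding abs_mult by (intro mult_le_one) auto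
  have bd: "norm (f k x) \<le> \<bar>c k\<bar>" for k x
    unfolding f_def using mult_left_mono[OF sin1, of "\<bar>c k\<bar>"] by (simp add: abs_mult mult.assoc)
  have "uniform_limit {0..1} (\<lambda>n x. \<Sum>k<n. f k x) (\<lambda>x. \<Sum>k. f k x) sequentially"
    by (rule Weierstrass_m_test[OF bd sum])
  then obtain I J where IJ: "\<And>n. ((\<lambda>x. \<Sum>k<n. f k x) has_integral I n) {0..1}"
      "((\<lambda>x. \<Sum>k. f k x) has_integral J) {0..1}" "I \<longlonglongrightarrow> J"
    by (rule uniform_limit_integral) (auto simp: f_def intro!: continuous_intros)
  have "I n = (\<Sum>k<n. if k = j then c j / 2 else 0)" for n
    by (rule has_integral_unique[OF IJ(1) has_integral_sum]) (use f in auto)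
  then have "I n = c j / 2" if "n > j" for n using that by (simp add: sum.delta')
  then have "eventually (\<lambda>n. I n = c j / 2) sequentially"
    unfolding eventually_sequentially by (intro exI[of _ "Suc j"]) auto
  then have "J = c j / 2"
    using IJ(3) LIMSEQ_unique tendsto_eventually by blast
  have "(\<Sum>k. f k x) = (\<Sum>k. c k * sin (2 * pi * q k * x + \<phi> k)) * sin (2 * pi * q j * x + \<phi> j)" for x
    unfolding f_def
  proof (rule suminf_mult2[symmetric])
    show "summable (\<lambda>k. c k * sin (2 * pi * real_of_int (q k) * x + \<phi> k))"
      by (rule summable_comparison_test'[OF sum, of 0])
        (simp add: abs_mult mult_left_le)
  qed
  then show ?thesis using IJ(2) unfolding \<open>J = c j / 2\<close> by simp
qed

text \<open>Subtraction on naturals is truncated, so one summand is always 0 and the value is |k -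
  l|.\<close>

definition nat_dist :: "nat \<Rightarrow> nat \<Rightarrow> nat" where
  "nat_dist k l = (k - l) + (l - k)"

lemma nat_dist_self [simp]: "nat_dist k k = 0"
  by (simp add: nat_dist_def)

lemma nat_dist_triangle: "nat_dist i k \<le> nat_dist i j + nat_dist j k"
  unfolding nat_dist_def by auto

lemma two_sided_geometric:
  fixes z :: real assumes "0 \<le> z" "z < 1"
  shows "summable (\<lambda>k. z ^ nat_dist k l)" "(\<Sum>k. z ^ nat_dist k l) \<le> 2 / (1 - z)"
proof -
  have geo: "(\<lambda>k. z ^ k) sums (1 / (1 - z))" using assms by (intro geometric_sums) simp
  have eq: "z ^ nat_dist (k + l) l = z ^ k" for k by (simp add: nat_dist_def)
  show sm: "summable (\<lambda>k. z ^ nat_dist k l)"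
    by (rule summable_iff_shift[of _ l, THEN iffD1]) (use geo in \<open>simp add: eq sums_iff\<close>)
  \<comment> \<open>Lowering the exponent by one lets the left tail be reindexed as an initial
    segment of the geometric series.\<close>
  have "(\<Sum>k<l. z ^ nat_dist k l) \<le> (\<Sum>k<l. z ^ (l - Suc k))"
    by (intro sum_mono power_decreasing) (use assms in \<open>auto simp: nat_dist_def\<close>)
  also have "\<dots> = (\<Sum>k<l. z ^ k)" by (rule sum.nat_diff_reindex)
  also have "\<dots> \<le> 1 / (1 - z)"
    using geo assms sum_le_suminf[of "\<lambda>k. z ^ k" "{..<l}"] by (simp add: sums_iff)
  finally have "(\<Sum>k<l. z ^ nat_dist k l) \<le> 1 / (1 - z)" .
  moreover have "(\<Sum>k. z ^ nat_dist k l) = (\<Sum>k. z ^ nat_dist (k + l) l) + (\<Sum>k<l. z ^ nat_dist k l)"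
    by (rule suminf_split_initial_segment[OF sm])
  moreover have "(\<Sum>k. z ^ nat_dist (k + l) l) = 1 / (1 - z)" using geo by (simp add: eq sums_iff)
  ultimately show "(\<Sum>k. z ^ nat_dist k l) \<le> 2 / (1 - z)" by simp
qed

text \<open>Since u grows at most linearly, the damped sequence \<open>v\<close> is bounded and some
  j reaches half of its supremum. Undoing the damping by the triangle inequality gives the growth
  factor 5/4, small enough to lose against the decay 3/4 of the amplitudes.\<close>

lemma almost_maximal_index:
  fixes u :: "nat \<Rightarrow> real"
  assumes u: "\<And>k. 0 \<le> u k" "\<And>k. u k \<le> real k" and "0 < u i"
  obtains j where "0 < u j" "u i \<le> 2 * u j" "\<And>k. u k \<le> 2 * u j * (5/4) ^ nat_dist k j"
proof -
  define v where "v k = u k * (4/5) ^ nat_dist k i" for k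
  have bern: "real m * (4/5) ^ m \<le> 4" for m :: nat
  proof -
    have "1 + real m * (1/4) \<le> (1 + 1/4) ^ m" by (rule Bernoulli_inequality) simp
    then have "real m \<le> 4 * (5/4) ^ m" by simp
    then have "real m * (4/5) ^ m \<le> 4 * (5/4) ^ m * (4/5) ^ m" by (intro mult_right_mono) auto
    also have "\<dots> = 4" by (simp add: power_mult_distrib[symmetric])
    finally show ?thesis .
  qed
  have "v k \<le> real i + 4" for k
  proof -
    have "u k \<le> real i + real (nat_dist k i)" using u(2)[of k] unfolding nat_dist_def by linarith
    then have "v k \<le> (real i + real (nat_dist k i)) * (4/5) ^ nat_dist k i"
      unfolding v_def by (intro mult_right_mono) auto
    also have "\<dots> \<le> real i + 4"
      unfolding distrib_right by (intro add_mono bern mult_left_le) (auto intro: power_le_one)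
    finally show ?thesis .
  qed
  then have bdd: "bdd_above (range v)" by (auto simp: bdd_above_def)
  have vi: "v i = u i" by (simp add: v_def)
  have "v i \<le> Sup (range v)" by (rule cSUP_upper[OF _ bdd]) simp
  then have "Sup (range v) / 2 < Sup (range v)" using assms(3) vi by simp
  then obtain j where "Sup (range v) / 2 < v j"
    using less_cSupE[of _ "range v"] by blast
  then have j: "v k \<le> 2 * v j" for k using cSUP_upper[OF _ bdd, of k] by simp
  have vj: "v j \<le> u j" unfolding v_def using u(1)[of j] by (intro mult_left_le power_le_one) auto
  show thesis
  proof
    show ui: "u i \<le> 2 * u j" using j[of i] vj vi by simp
    show "0 < u j" using ui assms(3) by simp
    fix k
    have "u k = v k * (5/4) ^ nat_dist k i" by (simp add: v_def power_mult_distrib[symmetric])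
    also have "\<dots> \<le> 2 * v j * (5/4) ^ nat_dist k i" by (intro mult_right_mono j) auto
    also have "\<dots> \<le> 2 * v j * (5/4) ^ (nat_dist k j + nat_dist j i)"
      using nat_dist_triangle[of k i j] u(1)[of j]
      by (intro mult_left_mono power_increasing) (auto simp: v_def)
    also have "\<dots> = 2 * u j * (5/4) ^ nat_dist k j"
      by (simp add: v_def power_add power_mult_distrib[symmetric])
    finally show "u k \<le> 2 * u j * (5/4) ^ nat_dist k j" .
  qed
qed

section \<open>The roof function\<close>

context convergents
begin

section \<open>Summability, positivity and Hoelder regularity of the roof\<close>

lemma summable_index_times_q_powr:
  assumes "0 < s" shows "summable (\<lambda>k. real k * real_of_int (q k) powr (- s))"
proof (rule summable_comparison_test')
  define z where "z = (4/3 :: real) powr (- s)"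
  have z: "0 < z" "z < 1" using powr_less_mono[of "- s" 0 "4/3"] assms by (simp_all add: z_def)
  have "summable (\<lambda>k. real (Suc k) * z ^ k)"
    using geometric_deriv_sums[of z] z by (simp add: sums_iff)
  then show "summable (\<lambda>k. 2 powr s * (real (Suc k) * z ^ k))" by (rule summable_mult)
  fix k :: nat
  have "(4/3) ^ k * 1 \<le> (4/3) ^ k * real_of_int (q 0)" using q_pos[of 0] by (intro mult_left_mono) auto
  also have "\<dots> \<le> 2 * q k" using q_growth[of k 0] by simp
  finally have "(4/3) ^ k / 2 \<le> real_of_int (q k)" by simp
  then have "real_of_int (q k) powr (- s) \<le> ((4/3) ^ k / 2) powr (- s)"
    using assms by (intro powr_mono2') auto
  also have "\<dots> = 2 powr s * z ^ k"
  proof -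
    have "z ^ k = ((4/3) ^ k) powr (- s)"
      by (simp add: z_def powr_powr flip: powr_realpow) (simp add: mult.commute)
    moreover have "((4/3) ^ k / 2) powr (- s) = ((4/3) ^ k) powr (- s) / 2 powr (- s)"
      by (rule powr_divide)
    ultimately show ?thesis by (simp only: powr_minus[of 2] divide_inverse inverse_inverse_eq mult.commute)
  qed
  finally have "real k * real_of_int (q k) powr (- s) \<le> real (Suc k) * (2 powr s * z ^ k)"
    by (intro mult_mono) auto
  then show "norm (real k * real_of_int (q k) powr (- s)) \<le> 2 powr s * (real (Suc k) * z ^ k)"
    by (simp add: mult.left_commute)
qed

text \<open>As \<open>weight 0 = 0\<close>, the possible coincidence \<open>q 0 = q 1\<close> is harmless.\<close>

definition weight :: "nat \<Rightarrow> real" where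
  "weight k = real k / q k"

definition roof :: "real \<Rightarrow> real" where
  "roof x = 1 + (\<Sum>k. weight k) + (\<Sum>k. weight k * cos (2 * pi * q k * x))"

lemma weight_nonneg: "0 \<le> weight k"
  using q_pos[of k] by (simp add: weight_def)

lemma summable_weight: "summable weight"
proof -
  have "weight = (\<lambda>k. real k * real_of_int (q k) powr (- 1))"
    using q_pos'[THEN less_imp_le] by (auto simp: weight_def powr_minus_divide)
  then show ?thesis using summable_index_times_q_powr[of 1] by simp
qed

lemma summable_weight_cos: "summable (\<lambda>k. weight k * cos (c k))"
  by (rule summable_comparison_test'[OF summable_weight])
    (auto simp: abs_mult weight_nonneg intro: mult_left_le)

text \<open>The constant \<open>suminf weight\<close> in the roof compensates the cosines: each
  weight times 1 + cos is nonnegative.\<close>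

lemma roof_ge_1: "1 \<le> roof x"
proof -
  have "0 \<le> weight k + weight k * cos y" for k y
    using mult_left_mono[OF cos_ge_minus_one[of y] weight_nonneg[of k]] by simp
  then have "0 \<le> (\<Sum>k. weight k + weight k * cos (2 * pi * q k * x))"
    by (intro suminf_nonneg summable_add summable_weight summable_weight_cos)
  then show ?thesis
    by (simp add: roof_def suminf_add[OF summable_weight summable_weight_cos, symmetric])
qed

lemma roof_periodic: "roof (x + of_int m) = roof x"
proof -
  have "cos (2 * pi * q k * (x + of_int m)) = cos (2 * pi * q k * x)" for k
  proof -
    have "cos (2 * pi * q k * (x + of_int m)) = cos (2 * pi * q k * x + 2 * pi * of_int (q k * m))"
      by (simp add: algebra_simps)
    then show ?thesis by (simp only: cos_add cos_int_2pin sin_int_2pin)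
  qed
  then show ?thesis by (simp add: roof_def)
qed

lemma roof_frac: "roof (frac x) = roof x"
  using roof_periodic[of "frac x" "\<lfloor>x\<rfloor>"] by (simp add: frac_def)

text \<open>The k-th mode changes by at most a multiple of \<open>weight k\<close> times the s-th
  power of q h. The part depending on k is k times q to the power s - 1, which is summable because s
  < 1.\<close>

lemma roof_translate_le:
  assumes "0 < s" "s < 1" "0 \<le> h"
  shows "\<bar>roof (x + h) - roof x\<bar> \<le> (\<Sum>k. 2 * pi * (real k * q k powr (- (1 - s)))) * h powr s"
proof -
  let ?d = "\<lambda>k. weight k * cos (2 * pi * q k * (x + h)) - weight k * cos (2 * pi * q k * x)"
  have sm: "summable (\<lambda>k. 2 * pi * (real k * q k powr (- (1 - s))) * h powr s)"
    using assms by (intro summable_mult2 summable_mult summable_index_times_q_powr) simp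
  have bd: "norm (?d k) \<le> 2 * pi * (real k * q k powr (- (1 - s))) * h powr s" for k
  proof -
    let ?t = "q k * h"
    have t: "0 \<le> ?t" using q_pos[of k] assms by simp
    have *: "cos (2 * pi * q k * (x + h)) - cos (2 * pi * q k * x)
        = 2 * sin (pi * q k * (2 * x + h)) * - sin (pi * ?t)"
      unfolding cos_diff_cos sin_minus[symmetric]
      by (intro arg_cong2[where f="\<lambda>a b. 2 * sin a * sin b"]) (simp_all add: algebra_simps)
    have "\<bar>cos (2 * pi * q k * (x + h)) - cos (2 * pi * q k * x)\<bar> \<le> 2 * \<bar>sin (pi * ?t)\<bar>"
      unfolding * abs_mult
      using mult_right_mono[of "2 * \<bar>sin (pi * q k * (2 * x + h))\<bar>" 2 "\<bar>sin (pi * ?t)\<bar>"] by simp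
    \<comment> \<open>For t \<le> 1 the linear bound on the sine is weakened to a power; for larger
      t the trivial bound 1 is enough.\<close>
    moreover have "\<bar>sin (pi * ?t)\<bar> \<le> pi * ?t powr s"
    proof (cases "?t \<le> 1")
      case True
      have "?t \<le> ?t powr s"
        using powr_mono'[of s 1 ?t] t True assms by (cases "?t = 0") auto
      then have "pi * ?t \<le> pi * ?t powr s" by (intro mult_left_mono) auto
      then show ?thesis using abs_sin_pi_le[of ?t] unfolding abs_of_nonneg[OF t] by linarith
    next
      case False
      have "1 * 1 \<le> pi * ?t powr s" using False assms pi_ge_two
        by (intro mult_mono ge_one_powr_ge_zero) auto
      then show ?thesis using abs_sin_le_one[of "pi * ?t"] by linarith
    qed
    ultimately have "\<bar>cos (2 * pi * q k * (x + h)) - cos (2 * pi * q k * x)\<bar>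
        \<le> 2 * pi * (q k powr s * h powr s)"
      using q_pos'[of k] assms by (simp add: powr_mult)
    then have "weight k * \<bar>cos (2 * pi * q k * (x + h)) - cos (2 * pi * q k * x)\<bar>
        \<le> weight k * (2 * pi * (q k powr s * h powr s))"
      by (rule mult_left_mono[OF _ weight_nonneg])
    also have "\<dots> = 2 * pi * (real k * q k powr (- (1 - s))) * h powr s"
      using q_pos'[of k] by (simp add: weight_def powr_diff)
    finally show ?thesis
      by (simp add: right_diff_distrib[symmetric] abs_mult weight_nonneg)
  qed
  have d: "roof (x + h) - roof x = (\<Sum>k. ?d k)"
    by (simp add: roof_def suminf_diff[OF summable_weight_cos summable_weight_cos])
  have "norm (\<Sum>k. ?d k) \<le> (\<Sum>k. 2 * pi * (real k * q k powr (- (1 - s))) * h powr s)"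
    by (rule norm_suminf_le[OF bd sm])
  moreover have "(\<Sum>k. 2 * pi * (real k * q k powr (- (1 - s))) * h powr s)
      = (\<Sum>k. 2 * pi * (real k * q k powr (- (1 - s)))) * h powr s"
    by (rule suminf_mult2[symmetric]) (use assms in \<open>intro summable_mult summable_index_times_q_powr, simp\<close>)
  ultimately show ?thesis unfolding d real_norm_def by (rule ord_le_eq_trans)
qed

lemma holder_roof:
  assumes "0 < s" "s < 1" shows "holder_on_circle s roof"
  unfolding holder_on_circle_def
proof (intro exI ballI)
  fix x y :: real
  let ?C = "\<Sum>k. 2 * pi * (real k * q k powr (- (1 - s)))"
  have *: "\<bar>roof x - roof y\<bar> \<le> ?C * frac (x - y) powr s" for x y
  proof -
    have "y + frac (x - y) = x + of_int (- \<lfloor>x - y\<rfloor>)" by (simp add: frac_def)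
    then have "roof x = roof (y + frac (x - y))" by (simp only: roof_periodic)
    then show ?thesis using roof_translate_le[OF assms, of "frac (x - y)" y] by simp
  qed
  show "\<bar>roof x - roof y\<bar> \<le> ?C * circle_dist x y powr s"
  proof (cases "frac (x - y) \<le> frac (y - x)")
    case True
    then show ?thesis using *[of x y] by (simp only: circle_dist_def min_def if_True)
  next
    case False
    then show ?thesis
      using *[of y x] by (simp only: circle_dist_def min_def if_False abs_minus_commute[of "roof x"])
  qed
qed

lemma continuous_roof: "continuous_on UNIV roof"
proof -
  have "uniform_limit UNIV (\<lambda>n x. \<Sum>k<n. weight k * cos (2 * pi * q k * x))
      (\<lambda>x. \<Sum>k. weight k * cos (2 * pi * q k * x)) sequentially"
    by (rule Weierstrass_m_test[OF _ summable_weight])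
      (auto simp: abs_mult weight_nonneg intro: mult_left_le)
  then have "continuous_on UNIV (\<lambda>x. \<Sum>k. weight k * cos (2 * pi * q k * x))"
    by (rule uniform_limit_theorem[rotated]) (auto intro!: always_eventually continuous_intros)
  then show ?thesis unfolding roof_def by (intro continuous_intros)
qed

text \<open>The modes of the Birkhoff sum of length \<open>n\<close> of \<open>x \<mapsto> roof (x + \<beta>) - roof x\<close>.\<close>

definition amplitude :: "real \<Rightarrow> nat \<Rightarrow> nat \<Rightarrow> real" where
  "amplitude \<beta> n k = - 2 * weight k * sin (pi * (of_int (q k) * \<beta>)) *
     (sin (real n * (pi * (q k * \<alpha>))) / sin (pi * (q k * \<alpha>)))"

definition phase :: "real \<Rightarrow> nat \<Rightarrow> nat \<Rightarrow> real" where
  "phase \<beta> n k = pi * (of_int (q k) * \<beta>) + (real n - 1) * (pi * (q k * \<alpha>))"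

lemma abs_sin_q_alpha: "\<bar>sin (pi * (q k * \<alpha>))\<bar> = \<bar>sin (pi * (q k * \<alpha> - p k))\<bar>"
  by (rule abs_sin_pi_diff_int[of "q k * \<alpha>" "p k", symmetric])

text \<open>From index 1 on the next denominator is at least 2, so q \<alpha> is within 1/2 of its
  numerator and the chord bound for the sine applies.\<close>

lemma abs_sin_q_alpha_ge:
  assumes "1 \<le> k" shows "1 / (A * q k) \<le> \<bar>sin (pi * (q k * \<alpha>))\<bar>"
proof -
  obtain m where m: "k = Suc m" using assms by (cases k) auto
  have "2 \<le> q (Suc k)" using q_double[of m] q_pos[of m] by (simp add: m)
  then have "1 / q (Suc k) \<le> 1 / 2" by (simp add: field_simps)
  then have "2 * \<bar>q k * \<alpha> - p k\<bar> \<le> \<bar>sin (pi * (q k * \<alpha>))\<bar>"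
    unfolding abs_sin_q_alpha using D_le[of k] by (intro abs_sin_pi_ge) linarith
  moreover have "1 / (A * q k) \<le> 1 / q (Suc k)"
    using q_Suc_le[of k] q_pos'[of "Suc k"] by (intro frac_le) auto
  ultimately show ?thesis using D_ge[of k] by (simp add: field_simps)
qed

lemma birkhoff_difference_series:
  shows "summable (\<lambda>k. amplitude \<beta> n k * sin (2 * pi * q k * x + phase \<beta> n k))"
    and "(\<Sum>i<n. roof (x + real i * \<alpha> + \<beta>) - roof (x + real i * \<alpha>)) =
      (\<Sum>k. amplitude \<beta> n k * sin (2 * pi * q k * x + phase \<beta> n k))"
proof -
  let ?y = "\<lambda>i. x + real i * \<alpha>"
  let ?d = "\<lambda>i k. weight k * cos (2 * pi * q k * (?y i + \<beta>)) - weight k * cos (2 * pi * q k * ?y i)"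
  have d: "summable (?d i)" for i by (intro summable_diff summable_weight_cos)
  have eq: "(\<Sum>i<n. ?d i k) = amplitude \<beta> n k * sin (2 * pi * q k * x + phase \<beta> n k)" for k
  \<comment> \<open>Mode 0 has weight 0; for the others the denominator \<open>sin ?z\<close> is
    nonzero by \<open>abs_sin_q_alpha_ge\<close>.\<close>
  proof (cases "k = 0")
    case True then show ?thesis by (simp add: weight_def amplitude_def)
  next
    case False
    let ?z = "pi * (q k * \<alpha>)" and ?w = "2 * pi * q k * x + pi * (of_int (q k) * \<beta>)"
    have "0 < 1 / (A * q k)" using A_ge_1 q_pos'[of k] by simp
    then have z: "sin ?z \<noteq> 0" using abs_sin_q_alpha_ge[of k] False by auto
    have "?d i k = - 2 * weight k * sin (pi * (of_int (q k) * \<beta>)) * sin (?w + 2 * real i * ?z)" for i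
    proof -
      have "cos (2 * pi * q k * (?y i + \<beta>)) - cos (2 * pi * q k * ?y i)
          = 2 * sin (?w + 2 * real i * ?z) * sin (- (pi * (of_int (q k) * \<beta>)))"
        unfolding cos_diff_cos by (rule arg_cong2[where f="\<lambda>a b. 2 * sin a * sin b"]) (simp_all add: algebra_simps)
      then show ?thesis by (simp add: right_diff_distrib[symmetric] mult.assoc)
    qed
    then have "(\<Sum>i<n. ?d i k) = - 2 * weight k * sin (pi * (of_int (q k) * \<beta>)) * (\<Sum>i<n. sin (?w + 2 * real i * ?z))"
      by (simp add: sum_distrib_left)
    also have "(\<Sum>i<n. sin (?w + 2 * real i * ?z)) = sin (real n * ?z) * sin (?w + (real n - 1) * ?z) / sin ?z"
      using sum_sin_progression[where y="?w" and z="?z" and n=n] z by (simp add: field_simps)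
    also have "?w + (real n - 1) * ?z = 2 * pi * q k * x + phase \<beta> n k"
      by (simp add: phase_def add.assoc)
    finally show ?thesis by (simp add: amplitude_def)
  qed
  show "summable (\<lambda>k. amplitude \<beta> n k * sin (2 * pi * q k * x + phase \<beta> n k))"
    using summable_sum[of "{..<n}" ?d] d by (simp add: eq)
  have "(\<Sum>i<n. roof (?y i + \<beta>) - roof (?y i)) = (\<Sum>i<n. \<Sum>k. ?d i k)"
    by (simp add: roof_def suminf_diff[OF summable_weight_cos summable_weight_cos])
  also have "\<dots> = (\<Sum>k. \<Sum>i<n. ?d i k)" by (rule suminf_sum[symmetric]) (rule d)
  finally show "(\<Sum>i<n. roof (?y i + \<beta>) - roof (?y i)) =
      (\<Sum>k. amplitude \<beta> n k * sin (2 * pi * q k * x + phase \<beta> n k))"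
    by (simp only: eq)
qed

text \<open>The \<open>k\<close>-th mode of \<open>x \<mapsto> roof (x + \<beta>) - roof x\<close> has amplitude \<open>2 * defect \<beta> k / q k\<close>.\<close>

definition defect :: "real \<Rightarrow> nat \<Rightarrow> real" where
  "defect \<beta> k = real k * \<bar>sin (pi * (of_int (q k) * \<beta>))\<bar>"

lemma abs_amplitude:
  "\<bar>amplitude \<beta> n k\<bar> = 2 * defect \<beta> k / q k * (\<bar>sin (real n * (pi * (q k * \<alpha>)))\<bar> / \<bar>sin (pi * (q k * \<alpha>))\<bar>)"
  using q_pos'[of k] by (simp add: amplitude_def defect_def weight_def abs_mult)

lemma abs_sin_q_q_alpha: "\<bar>sin (q l * (pi * (q k * \<alpha>)))\<bar> = \<bar>sin (pi * (q l * (q k * \<alpha> - p k)))\<bar>"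
proof -
  have "pi * (q l * (q k * \<alpha> - p k)) = pi * (q l * (q k * \<alpha>) - of_int (q l * p k))"
    by (simp add: algebra_simps)
  then have "\<bar>sin (pi * (q l * (q k * \<alpha> - p k)))\<bar> = \<bar>sin (pi * (q l * (q k * \<alpha>)))\<bar>"
    by (simp only: abs_sin_pi_diff_int)
  then show ?thesis by (simp add: mult.left_commute)
qed

lemma abs_sin_q_q_alpha_le: "\<bar>sin (q l * (pi * (q k * \<alpha>)))\<bar> \<le> pi * (q l / q k)"
proof -
  have "\<bar>q k * \<alpha> - p k\<bar> \<le> 1 / q k"
    using D_le[of k] by (rule order_trans) (use q_Suc_ge[of k] q_pos'[of k] in \<open>intro frac_le, auto\<close>)
  then have "q l * \<bar>q k * \<alpha> - p k\<bar> \<le> q l * (1 / q k)"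
    using q_pos'[of l] by (intro mult_left_mono) auto
  then have "pi * \<bar>q l * (q k * \<alpha> - p k)\<bar> \<le> pi * (q l * (1 / q k))"
    using q_pos'[of l] by (intro mult_left_mono) (auto simp: abs_mult)
  then show ?thesis using abs_sin_pi_le[of "q l * (q k * \<alpha> - p k)"] unfolding abs_sin_q_q_alpha by simp
qed

text \<open>The sine in the numerator is symmetric in k and l, so it is bounded by the smaller
  denominator over the larger one, which decays geometrically. The bound A q on the reciprocal of
  the other sine cancels the q in the weight.\<close>

lemma amplitude_le:
  assumes "real n = q l"
  shows "\<bar>amplitude \<beta> n k\<bar> \<le> 4 * pi * A * defect \<beta> k * (3/4) ^ nat_dist k l"
proof (cases "k = 0")
  case True
  then show ?thesis by (simp add: amplitude_def weight_def defect_def)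
next
  case False
  have ratio: "q i / q (i + m) \<le> 2 * (3/4) ^ m" for i m
  proof -
    have "q i = (3/4) ^ m * ((4/3) ^ m * real_of_int (q i))" by (simp add: mult.assoc[symmetric] power_mult_distrib[symmetric])
    also have "\<dots> \<le> (3/4) ^ m * (2 * q (i + m))" by (intro mult_left_mono q_growth) auto
    finally show ?thesis using q_pos'[of "i + m"] by (simp add: field_simps)
  qed
  have "\<bar>sin (q l * (pi * (q k * \<alpha>)))\<bar> \<le> pi * (2 * (3/4) ^ nat_dist k l)"
  proof (cases "k \<le> l")
    case True
    have swap: "q l * (pi * (q k * \<alpha>)) = q k * (pi * (q l * \<alpha>))" by simp
    then have "\<bar>sin (q l * (pi * (q k * \<alpha>)))\<bar> \<le> pi * (q k / q l)"
      by (subst swap) (rule abs_sin_q_q_alpha_le)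
    also have "\<dots> \<le> pi * (2 * (3/4) ^ nat_dist k l)"
      using ratio[of k "l - k"] True by (intro mult_left_mono) (auto simp: nat_dist_def)
    finally show ?thesis .
  next
    case False
    have "\<bar>sin (q l * (pi * (q k * \<alpha>)))\<bar> \<le> pi * (q l / q k)" by (rule abs_sin_q_q_alpha_le)
    also have "\<dots> \<le> pi * (2 * (3/4) ^ nat_dist k l)"
      using ratio[of l "k - l"] False by (intro mult_left_mono) (auto simp: nat_dist_def)
    finally show ?thesis .
  qed
  moreover have "1 / \<bar>sin (pi * (q k * \<alpha>))\<bar> \<le> A * q k"
  proof -
    have "0 < 1 / (A * q k)" using A_ge_1 q_pos'[of k] by simp
    then have "inverse \<bar>sin (pi * (q k * \<alpha>))\<bar> \<le> inverse (1 / (A * q k))"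
      using abs_sin_q_alpha_ge[of k] False by (intro le_imp_inverse_le) auto
    then show ?thesis by (simp add: inverse_eq_divide)
  qed
  ultimately have "\<bar>sin (q l * (pi * (q k * \<alpha>)))\<bar> * (1 / \<bar>sin (pi * (q k * \<alpha>))\<bar>)
      \<le> pi * (2 * (3/4) ^ nat_dist k l) * (A * q k)"
    by (intro mult_mono) auto
  moreover have "0 \<le> 2 * defect \<beta> k / q k" using q_pos'[of k] by (simp add: defect_def)
  ultimately have "\<bar>amplitude \<beta> n k\<bar> \<le> 2 * defect \<beta> k / q k * (pi * (2 * (3/4) ^ nat_dist k l) * (A * q k))"
    unfolding abs_amplitude assms by (intro mult_left_mono) auto
  also have "\<dots> = 4 * pi * A * defect \<beta> k * (3/4) ^ nat_dist k l"
    using q_pos'[of k] by (simp add: field_simps)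
  finally show ?thesis .
qed

text \<open>Mode l + 1 is chosen because \<open>q l\<close> times the error of index l + 1 is at
  most \<open>q l / q (l + 2)\<close>, hence at most 1/2. There the sine is comparable to its
  argument, so the quotient of sines is at least q l / 2.\<close>

lemma amplitude_Suc_ge:
  assumes "real n = q l"
  shows "defect \<beta> (Suc l) / A \<le> \<bar>amplitude \<beta> n (Suc l)\<bar>"
proof -
  let ?k = "Suc l" and ?D = "\<bar>q (Suc l) * \<alpha> - p (Suc l)\<bar>"
  have "q l * ?D \<le> q l * (1 / q (Suc ?k))" using D_le[of ?k] q_pos'[of l] by (intro mult_left_mono) auto
  also have "\<dots> \<le> 1 / 2"
    using q_double[of l] q_pos'[of "Suc ?k"] by (simp add: field_simps)
  finally have "2 * \<bar>q l * (q ?k * \<alpha> - p ?k)\<bar> \<le> \<bar>sin (q l * (pi * (q ?k * \<alpha>)))\<bar>"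
    unfolding abs_sin_q_q_alpha using q_pos'[of l] by (intro abs_sin_pi_ge) (simp add: abs_mult)
  then have num: "2 * q l * ?D \<le> \<bar>sin (q l * (pi * (q ?k * \<alpha>)))\<bar>"
    using q_pos'[of l] by (simp add: abs_mult)
  have den: "\<bar>sin (pi * (q ?k * \<alpha>))\<bar> \<le> pi * ?D"
    unfolding abs_sin_q_alpha by (rule abs_sin_pi_le)
  have "0 < 1 / (A * q ?k)" using A_ge_1 q_pos'[of ?k] by simp
  then have pos: "0 < \<bar>sin (pi * (q ?k * \<alpha>))\<bar>" using abs_sin_q_alpha_ge[of ?k] by linarith
  have "2 * q l / pi * \<bar>sin (pi * (q ?k * \<alpha>))\<bar> \<le> 2 * q l / pi * (pi * ?D)"
    using q_pos'[of l] by (intro mult_left_mono den) auto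
  also have "\<dots> \<le> \<bar>sin (q l * (pi * (q ?k * \<alpha>)))\<bar>" using num by simp
  finally have "2 * q l / pi \<le> \<bar>sin (q l * (pi * (q ?k * \<alpha>)))\<bar> / \<bar>sin (pi * (q ?k * \<alpha>))\<bar>"
    using pos by (simp add: field_simps)
  moreover have "q l / 2 \<le> 2 * q l / pi"
    using pi_less_4 q_pos'[of l] by (simp add: field_simps)
  ultimately have ge: "q l / 2 \<le> \<bar>sin (q l * (pi * (q ?k * \<alpha>)))\<bar> / \<bar>sin (pi * (q ?k * \<alpha>))\<bar>"
    by linarith
  have "q ?k / A \<le> q l" using q_Suc_le[of l] A_ge_1 by (simp add: field_simps)
  from order_trans[OF divide_right_mono[OF this, of 2] ge]
  have "2 * defect \<beta> ?k / q ?k * (q ?k / A / 2) \<le> 2 * defect \<beta> ?k / q ?k *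
      (\<bar>sin (q l * (pi * (q ?k * \<alpha>)))\<bar> / \<bar>sin (pi * (q ?k * \<alpha>))\<bar>)"
    using q_pos'[of ?k] by (intro mult_left_mono) (auto simp: defect_def)
  then show ?thesis unfolding abs_amplitude assms using q_pos'[of ?k] by simp
qed

end

section \<open>Solutions of the functional equation\<close>

context convergents
begin

lemma defect_bounds: "0 \<le> defect \<beta> k" "defect \<beta> k \<le> real k"
  by (auto simp: defect_def intro: mult_left_le)

text \<open>Moving the centre from l + 1 to l costs a factor 5/4; growth 5/4 against decay 3/4
  leaves 15/16.\<close>

lemma amplitude_le_geometric:
  assumes n: "real n = q l" and u: "\<And>k. defect \<beta> k \<le> 2 * U * (5/4) ^ nat_dist k (Suc l)" and "0 \<le> U"
  shows "\<bar>amplitude \<beta> n k\<bar> \<le> 10 * pi * A * U * (15/16) ^ nat_dist k l"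
proof -
  have "nat_dist k (Suc l) \<le> Suc (nat_dist k l)"
    using nat_dist_triangle[of k "Suc l" l] by (simp add: nat_dist_def)
  then have "(5/4 :: real) ^ nat_dist k (Suc l) \<le> (5/4) ^ Suc (nat_dist k l)"
    by (intro power_increasing) auto
  then have "2 * U * (5/4) ^ nat_dist k (Suc l) \<le> 2 * U * (5/4) ^ Suc (nat_dist k l)"
    using \<open>0 \<le> U\<close> by (intro mult_left_mono) auto
  then have "defect \<beta> k \<le> 5 / 2 * U * (5/4) ^ nat_dist k l"
    using u[of k] by simp
  then have "4 * pi * A * defect \<beta> k * (3/4) ^ nat_dist k l
      \<le> 4 * pi * A * (5 / 2 * U * (5/4) ^ nat_dist k l) * (3/4) ^ nat_dist k l"
    using A_ge_1 by (intro mult_right_mono mult_left_mono) auto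
  also have "\<dots> = 10 * pi * A * U * ((5/4) ^ nat_dist k l * (3/4) ^ nat_dist k l)" by simp
  also have "(5/4) ^ nat_dist k l * (3/4) ^ nat_dist k l = (15/16 :: real) ^ nat_dist k l"
    by (simp add: power_mult_distrib[symmetric])
  finally show ?thesis using amplitude_le[OF n, of \<beta> k] by linarith
qed

text \<open>For a nearly maximal defect U at j = l + 1, the Birkhoff sum of length
  \<open>q l\<close> has sup norm at most \<open>C0 * U\<close> and a coefficient of size at least U
  / A at frequency \<open>q j\<close>. It is also at most 2 M off a set of measure 2 \<delta>.
  Comparing these bounds U by 8 A M.\<close>

lemma defect_bounded:
  fixes \<beta> :: real and G :: "real \<Rightarrow> real"
  assumes G [measurable]: "G \<in> borel_measurable borel" and per: "\<And>x. G (frac x) = G x"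
    and cob: "AE x in lborel. roof (x + \<beta>) - roof x = G (x + \<alpha>) - G x"
  shows "\<exists>C. \<forall>i. defect \<beta> i \<le> C"
proof -
  \<comment> \<open>The value is 10 \<pi> A times the bound 2 / (1 - 15/16) = 32 on the two-sided
    geometric series.\<close>
  define C0 where "C0 = 320 * pi * A"
  have C0: "C0 > 0" using A_ge_1 by (simp add: C0_def)
  \<comment> \<open>With this choice the exceptional set contributes at most U / (4 A), half of the
    lower bound U / (2 A) for the integral.\<close>
  define \<delta> where "\<delta> = 1 / (8 * A * C0)"
  have "\<delta> > 0" using C0 A_ge_1 by (simp add: \<delta>_def)
  then obtain M where M: "M > 0" "\<And>t. measure lborel {x \<in> {0..1}. M < \<bar>G (x + t)\<bar>} \<le> \<delta>"
    using periodic_tight[OF G per] by blast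
  have "AE x in lborel. \<forall>i::nat. roof (x + real i * \<alpha> + \<beta>) - roof (x + real i * \<alpha>)
      = G (x + real (Suc i) * \<alpha>) - G (x + real i * \<alpha>)"
  proof (subst AE_all_countable, intro allI)
    fix i :: nat
    show "AE x in lborel. roof (x + real i * \<alpha> + \<beta>) - roof (x + real i * \<alpha>)
      = G (x + real (Suc i) * \<alpha>) - G (x + real i * \<alpha>)"
      using AE_lborel_translate[OF cob, of "real i * \<alpha>"] by (simp add: algebra_simps)
  qed
  then obtain N where N: "N \<in> sets borel" "emeasure lborel N = 0"
    "\<And>x i. x \<notin> N \<Longrightarrow> roof (x + real i * \<alpha> + \<beta>) - roof (x + real i * \<alpha>)
      = G (x + real (Suc i) * \<alpha>) - G (x + real i * \<alpha>)"
    by (rule AE_E) (auto simp: subset_eq)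
  have "defect \<beta> i \<le> 16 * A * M" for i
  proof (cases "defect \<beta> i = 0")
    case True
    then show ?thesis using A_ge_1 M(1) by simp
  next
    case False
    then obtain j where j: "0 < defect \<beta> j" "defect \<beta> i \<le> 2 * defect \<beta> j"
        "\<And>k. defect \<beta> k \<le> 2 * defect \<beta> j * (5/4) ^ nat_dist k j"
      using almost_maximal_index[of "defect \<beta>" i] defect_bounds order_le_less by metis
    \<comment> \<open>The defect at index 0 vanishes, so j is a successor.\<close>
    then obtain l where l: "j = Suc l" by (cases j) (auto simp: defect_def)
    define U where "U = defect \<beta> j"
    define n where "n = nat (q l)"
    have n: "real n = q l" using q_pos[of l] by (simp add: n_def)
    have amp: "\<bar>amplitude \<beta> n k\<bar> \<le> 10 * pi * A * U * (15/16) ^ nat_dist k l" for k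
      by (rule amplitude_le_geometric[OF n]) (use j l U_def in auto)
    have geo: "summable (\<lambda>k. 10 * pi * A * U * (15/16) ^ nat_dist k l)"
      by (intro summable_mult two_sided_geometric) auto
    have "(\<Sum>k. 10 * pi * A * U * (15/16) ^ nat_dist k l) = 10 * pi * A * U * (\<Sum>k. (15/16) ^ nat_dist k l)"
      by (intro suminf_mult two_sided_geometric) auto
    also have "\<dots> \<le> 10 * pi * A * U * (2 / (1 - 15/16))"
      using A_ge_1 j(1) by (intro mult_left_mono two_sided_geometric) (auto simp: U_def)
    finally have geo_le: "(\<Sum>k. 10 * pi * A * U * (15/16) ^ nat_dist k l) \<le> C0 * U"
      by (simp add: C0_def)
    define H where "H x = (\<Sum>k. amplitude \<beta> n k * sin (2 * pi * q k * x + phase \<beta> n k))" for x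
    have H_le: "\<bar>H x\<bar> \<le> C0 * U" for x
    proof -
      have "norm (amplitude \<beta> n k * sin (2 * pi * q k * x + phase \<beta> n k))
          \<le> 10 * pi * A * U * (15/16) ^ nat_dist k l" for k
        using mult_left_le[of "\<bar>sin (2 * pi * q k * x + phase \<beta> n k)\<bar>" "\<bar>amplitude \<beta> n k\<bar>"] amp[of k]
        by (simp add: abs_mult)
      from norm_suminf_le[OF this geo] show ?thesis using geo_le by (simp add: H_def)
    qed
    have H_eq: "H x = G (x + real n * \<alpha>) - G x" if "x \<notin> N" for x
    proof -
      have "H x = (\<Sum>i<n. G (x + real (Suc i) * \<alpha>) - G (x + real i * \<alpha>))"
        unfolding H_def birkhoff_difference_series(2)[symmetric] using N(3)[OF that] by simp
      also have "\<dots> = G (x + real n * \<alpha>) - G x"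
        using sum_lessThan_telescope[of "\<lambda>i. G (x + real i * \<alpha>)" n] by simp
      finally show ?thesis .
    qed
    let ?s = "\<lambda>x. sin (2 * pi * q j * x + phase \<beta> n j)"
    have int: "((\<lambda>x. H x * ?s x) has_integral amplitude \<beta> n j / 2) {0..1}"
      unfolding H_def
    proof (rule has_integral_sine_coefficient)
      show "summable (\<lambda>k. \<bar>amplitude \<beta> n k\<bar>)"
        by (rule summable_comparison_test'[OF geo, of 0]) (use amp in auto)
      show "q k \<noteq> q j" if "k \<noteq> j" "amplitude \<beta> n k \<noteq> 0" for k
      proof -
        have "k \<noteq> 0" using that(2) by (auto simp: amplitude_def weight_def)
        then show ?thesis using q_strict[of k j] q_strict[of j k] that(1) l by (cases "k < j") auto
      qed
    qed (rule q_pos')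
    define B where "B t = {x \<in> {0..1}. M < \<bar>G (x + t)\<bar>}" for t
    have [measurable]: "B t \<in> sets borel" for t unfolding B_def by measurable
    have B_fm: "B t \<in> fmeasurable lborel" for t
    proof (rule fmeasurableI2[of "{0..1}"])
      show "{0..1::real} \<in> fmeasurable lborel" by (intro fmeasurableI) auto
    qed (auto simp: B_def)
    \<comment> \<open>Outside these sets both terms of the telescoped sum are at most M and the
      functional equation holds along the whole orbit segment.\<close>
    define E where "E = B 0 \<union> B (real n * \<alpha>) \<union> (N \<inter> {0..1})"
    have N_null: "N \<inter> {0..1} \<in> null_sets lborel"
      using N by (intro null_set_Int2) auto
    have "measure lborel E = measure lborel (B 0 \<union> B (real n * \<alpha>))"
      unfolding E_def by (rule measure_Un_null_set) (use N_null in auto)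
    also have "\<dots> \<le> measure lborel (B 0) + measure lborel (B (real n * \<alpha>))"
      by (rule measure_Un_le) auto
    also have "\<dots> \<le> \<delta> + \<delta>" unfolding B_def by (intro add_mono M(2))
    finally have mE: "measure lborel E \<le> 2 * \<delta>" by simp
    have s_le: "\<bar>H x * ?s x\<bar> \<le> \<bar>H x\<bar>" for x by (simp add: abs_mult mult_left_le)
    have "\<bar>amplitude \<beta> n j / 2\<bar> \<le> 2 * M + C0 * U * measure lborel E"
    proof (rule has_integral_bound_off_small_set[OF int])
      show "E \<in> sets borel" using N(1) unfolding E_def by simp
      show "E \<subseteq> {0..1}" by (auto simp: E_def B_def)
      show "\<bar>H x * ?s x\<bar> \<le> C0 * U" for x using s_le[of x] H_le[of x] by linarith
      show "\<bar>H x * ?s x\<bar> \<le> 2 * M" if "x \<in> {0..1} - E" for x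
      proof -
        have "\<bar>G x\<bar> \<le> M" "\<bar>G (x + real n * \<alpha>)\<bar> \<le> M" "x \<notin> N"
          using that by (auto simp: E_def B_def not_less)
        then show ?thesis using s_le[of x] H_eq[of x] by linarith
      qed
    qed (use M in auto)
    also have "C0 * U * measure lborel E \<le> C0 * U * (2 * \<delta>)"
      using mE C0 j(1) by (intro mult_left_mono) (auto simp: U_def)
    also have "C0 * U * (2 * \<delta>) = U / (4 * A)" using C0 A_ge_1 by (simp add: \<delta>_def)
    finally have "\<bar>amplitude \<beta> n j\<bar> / 2 \<le> 2 * M + U / (4 * A)" by simp
    moreover have "U / A \<le> \<bar>amplitude \<beta> n j\<bar>" using amplitude_Suc_ge[OF n, of \<beta>] by (simp add: U_def l)
    ultimately have "U / A / 2 \<le> 2 * M + U / A / 4" by simp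
    moreover have "v \<le> 8 * M" if "v / 2 \<le> 2 * M + v / 4" for v using that by linarith
    ultimately have "U / A \<le> 8 * M" by blast
    then have "U \<le> 8 * A * M" using A_ge_1 by (simp add: field_simps)
    then show ?thesis using j(2) by (simp add: U_def)
  qed
  then show ?thesis by blast
qed

text \<open>The factor k in the weights is decisive: a bounded defect puts \<open>q k\<close> times
  \<beta> within C / k of an integer, so the Diophantine criterion applies.\<close>

lemma roof_coboundary:
  fixes \<beta> :: real and g :: "real \<Rightarrow> real"
  assumes g: "g \<in> borel_measurable circle"
    and cob: "AE x in circle. roof (rotation \<beta> x) - roof x = g (rotation \<alpha> x) - g x"
  shows "\<exists>m n :: int. \<beta> = of_int m * \<alpha> + of_int n"
proof -
  obtain G where G: "G \<in> borel_measurable borel" "\<And>x. G (frac x) = G x" "AE x in circle. G x = g x"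
    using circle_borel_representative[OF g] by blast
  have Gg: "AE x in lborel. G x = g (frac x)"
    using AE_circle_imp_AE_frac[OF G(3)] by (simp add: G(2))
  have "AE x in lborel. roof (x + \<beta>) - roof x = G (x + \<alpha>) - G x"
    using AE_circle_imp_AE_frac[OF cob] Gg AE_lborel_translate[OF Gg, of \<alpha>]
    by eventually_elim (simp add: rotation_def roof_frac)
  then obtain C where C: "\<And>i. defect \<beta> i \<le> C" using defect_bounded[OF G(1,2)] by blast
  show ?thesis
  proof (rule bounded_type_characterization)
    let ?\<theta> = "\<lambda>k. of_int (q k) * \<beta> - of_int (round (of_int (q k) * \<beta>))"
    have "norm (?\<theta> k) \<le> C / real k" if "k > 0" for k
    proof -
      have "\<bar>?\<theta> k\<bar> \<le> 1 / 2"
        using of_int_round_abs_le[of "of_int (q k) * \<beta>"] by (simp add: abs_minus_commute)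
      from abs_sin_pi_ge[OF this]
      have "2 * \<bar>?\<theta> k\<bar> \<le> \<bar>sin (pi * (of_int (q k) * \<beta>))\<bar>" unfolding abs_sin_pi_diff_int .
      moreover have "\<bar>?\<theta> k\<bar> \<le> 2 * \<bar>?\<theta> k\<bar>" by simp
      ultimately have "\<bar>?\<theta> k\<bar> \<le> \<bar>sin (pi * (of_int (q k) * \<beta>))\<bar>" by (rule order_trans[rotated])
      then have "real k * \<bar>?\<theta> k\<bar> \<le> defect \<beta> k" unfolding defect_def by (intro mult_left_mono) auto
      then show ?thesis using C[of k] that by (simp add: field_simps)
    qed
    then show "?\<theta> \<longlonglongrightarrow> 0"
      by (intro Lim_null_comparison[OF _ lim_const_over_n[of C]] eventually_sequentiallyI[of 1]) auto
  qed
qed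

end

section \<open>Commuting maps and orbits\<close>

text \<open>An explicit two-sided orbit determines all iterates; for negative ones injectivity
  identifies \<open>inv_into\<close> with the backward step.\<close>

lemma ziter_orbit:
  fixes \<phi> :: "int \<Rightarrow> 'a"
  assumes inj: "inj_on T A" and A: "\<And>i. \<phi> i \<in> A" and T: "\<And>i. T (\<phi> i) = \<phi> (i + 1)"
  shows "ziter A T n (\<phi> 0) = \<phi> n"
proof -
  have fwd: "(T ^^ k) (\<phi> 0) = \<phi> (int k)" for k
    by (induction k) (simp_all add: T add.commute)
  have inv: "inv_into A T (\<phi> i) = \<phi> (i - 1)" for i
    using inv_into_f_f[OF inj A, of "i - 1"] T[of "i - 1"] by simp
  have bwd: "(inv_into A T ^^ k) (\<phi> 0) = \<phi> (- int k)" for k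
    by (induction k) (simp_all add: inv minus_diff_commute)
  show ?thesis
    using fwd[of "nat n"] bwd[of "nat (- n)"] by (cases "n \<ge> 0") (simp_all add: ziter_def)
qed

lemma frac_add_of_int: "frac (x + of_int n) = frac (x::real)"
  by (simp add: frac_def)

lemma inj_on_rotation: "inj_on (rotation \<alpha>) {0..<1}"
proof (rule inj_on_inverseI)
  fix x :: real assume "x \<in> {0..<1}"
  then show "rotation (- \<alpha>) (rotation \<alpha> x) = x"
    by (simp only: rotation_def frac_add_simps) simp
qed

lemma rotation_funpow: "(rotation \<alpha> ^^ i) (frac x) = frac (x + real i * \<alpha>)"
  by (induction i) (simp_all add: rotation_def algebra_simps)

lemma ziter_rotation: "ziter {0..<1} (rotation \<alpha>) n (frac x) = frac (x + of_int n * \<alpha>)"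
  using ziter_orbit[OF inj_on_rotation, of "\<lambda>i. frac (x + of_int i * \<alpha>)" \<alpha> n]
  by (simp add: rotation_def frac_lt_1 algebra_simps)

lemma borel_measurable_circle:
  "f \<in> borel_measurable borel \<Longrightarrow> f \<in> borel_measurable circle"
  unfolding circle_def by (intro measurable_restrict_space1 measurable_completion) simp

text \<open>A null set of the base times the whole line is null in the product, and neither
  restriction nor scaling destroys this.\<close>

lemma AE_special_measure_fst:
  assumes f: "f \<in> borel_measurable circle" and P: "AE x in circle. P x"
  shows "AE y in special_measure circle f. P (fst y) \<and> y \<in> special_space circle f"
proof -
  let ?M = "circle \<Otimes>\<^sub>M (lborel :: real measure)"
  let ?S = "special_space circle f"
  have "?S = {y \<in> space ?M. 0 \<le> snd y \<and> snd y < f (fst y)}"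
    by (auto simp: special_space_def space_pair_measure)
  also have "\<dots> \<in> sets ?M"
    using f by measurable
  finally have S: "?S \<in> sets ?M" .
  obtain N where N: "N \<in> sets circle" "emeasure circle N = 0" "\<And>x. x \<in> {0..<1} \<Longrightarrow> x \<notin> N \<Longrightarrow> P x"
    using P by (rule AE_E) auto
  have "N \<times> UNIV \<in> null_sets ?M"
    using lborel.emeasure_pair_measure_Times[of N circle UNIV] N by (intro null_setsI) auto
  then have "AE y in ?M. y \<notin> N \<times> UNIV" by (rule AE_not_in)
  then have "AE y in ?M. y \<in> ?S \<longrightarrow> P (fst y) \<and> y \<in> ?S"
    by eventually_elim (use N(3) in \<open>fastforce simp: special_space_def\<close>)
  then have "AE y in restrict_space ?M ?S. P (fst y) \<and> y \<in> ?S"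
    using S by (subst AE_restrict_space_iff) auto
  then obtain K where "K \<in> sets (restrict_space ?M ?S)" "emeasure (restrict_space ?M ?S) K = 0"
      "{y \<in> space (restrict_space ?M ?S). \<not> (P (fst y) \<and> y \<in> ?S)} \<subseteq> K"
    by (rule AE_E)
  then show ?thesis
    by (intro AE_I[of _ _ K]) (auto simp: special_measure_def space_scale_measure)
qed

text \<open>The displacement S x - x is invariant modulo 1. Its cosine and sine are real invariant
  functions, constant by ergodicity, and together they determine it modulo 1.\<close>

lemma commuting_with_rotation:
  assumes S: "S \<in> circle \<rightarrow>\<^sub>M circle" and irr: "\<alpha> \<notin> \<rat>"
    and comm: "AE x in circle. S (rotation \<alpha> x) = rotation \<alpha> (S x)"
  obtains \<beta> where "AE x in circle. S x = rotation \<beta> x"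
proof -
  have id [measurable]: "(\<lambda>x. x) \<in> borel_measurable circle"
    by (rule borel_measurable_circle) simp
  have [measurable]: "S \<in> borel_measurable circle"
    using measurable_compose[OF S id] by simp
  have *: "f (2 * pi * (S (rotation \<alpha> x) - rotation \<alpha> x)) = f (2 * pi * (S x - x))"
    if "S (rotation \<alpha> x) = rotation \<alpha> (S x)" "f = cos \<or> f = sin" for x and f :: "real \<Rightarrow> real"
  proof -
    have "2 * pi * (S (rotation \<alpha> x) - rotation \<alpha> x) =
        2 * pi * (S x - x) + 2 * pi * of_int (\<lfloor>x + \<alpha>\<rfloor> - \<lfloor>S x + \<alpha>\<rfloor>)"
      unfolding that(1) by (simp add: rotation_def frac_def algebra_simps)
    then have "sin (2 * pi * (S (rotation \<alpha> x) - rotation \<alpha> x)) = sin (2 * pi * (S x - x)) \<and>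
        cos (2 * pi * (S (rotation \<alpha> x) - rotation \<alpha> x)) = cos (2 * pi * (S x - x))"
      unfolding sin_cos_eq_iff by blast
    then show ?thesis using that(2) by blast
  qed
  have "\<exists>c. AE x in circle. f (2 * pi * (S x - x)) = c" if f: "f = cos \<or> f = sin" for f :: "real \<Rightarrow> real"
  proof (rule rotation_ergodic[OF _ irr])
    show "(\<lambda>x. f (2 * pi * (S x - x))) \<in> borel_measurable circle" using f by auto
    show "AE x in circle. f (2 * pi * (S (rotation \<alpha> x) - rotation \<alpha> x)) = f (2 * pi * (S x - x))"
      using comm by eventually_elim (rule *[OF _ f])
  qed
  from this[of cos] this[of sin] obtain c s where "AE x in circle. cos (2 * pi * (S x - x)) = c"
      "AE x in circle. sin (2 * pi * (S x - x)) = s" by auto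
  then have ae: "AE x in circle. cos (2 * pi * (S x - x)) = c \<and> sin (2 * pi * (S x - x)) = s"
    by eventually_elim simp
  \<comment> \<open>Since the circle has positive measure, some point realises both constants, and
    its displacement serves as \<beta>.\<close>
  have "\<exists>y. cos (2 * pi * (S y - y)) = c \<and> sin (2 * pi * (S y - y)) = s"
  proof (rule ccontr)
    assume "\<not> ?thesis"
    then have "AE x in circle. False" using ae by (auto elim: eventually_mono)
    then have "AE x in lborel. (x::real) \<notin> {0..<1}" by (simp add: AE_circle_iff)
    then have "emeasure lborel {0..<1::real} = 0" by (subst (asm) AE_iff_measurable[of "{0..<1}"]) auto
    then show False by simp
  qed
  then obtain y where y: "cos (2 * pi * (S y - y)) = c" "sin (2 * pi * (S y - y)) = s" by blast
  have "AE x in circle. S x = rotation (S y - y) x"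
    using ae AE_space
  proof eventually_elim
    case (elim x)
    then obtain n :: int where "2 * pi * (S x - x) = 2 * pi * (S y - y) + 2 * pi * n"
      using sin_cos_eq_iff[of "2 * pi * (S x - x)" "2 * pi * (S y - y)"] y by auto
    then have "2 * pi * (S x - x) = 2 * pi * (S y - y + n)" by (simp add: distrib_left)
    then have "S x = x + (S y - y) + n" by simp
    moreover have "S x \<in> {0..<1}" using measurable_space[OF S elim(2)] by simp
    ultimately show ?case
      using frac_eq[of "S x"] frac_add_of_int[of "x + (S y - y)" n] by (simp add: rotation_def)
  qed
  then show thesis by (rule that)
qed

section \<open>The Birkhoff cocycle, skew product orbits and the special flow\<close>

context convergents
begin

text \<open>The Birkhoff sum written on the line, free of \<open>frac\<close> and
  \<open>ziter\<close>; periodicity of the roof identifies the two in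
  \<open>birkhoff_sum_roof\<close>.\<close>

definition cocycle :: "int \<Rightarrow> real \<Rightarrow> real" where
  "cocycle m x = (if m \<ge> 0 then \<Sum>i<nat m. roof (x + real i * \<alpha>)
     else - (\<Sum>i<nat (- m). roof (x + of_int m * \<alpha> + real i * \<alpha>)))"

lemma cocycle_0 [simp]: "cocycle 0 x = 0"
  by (simp add: cocycle_def)

lemma cocycle_succ: "cocycle (m + 1) x = cocycle m x + roof (x + of_int m * \<alpha>)"
proof (cases "m \<ge> 0")
  case True
  then have "nat (m + 1) = Suc (nat m)" by simp
  then show ?thesis using True by (simp add: cocycle_def)
next
  case False
  define k where "k = nat (- m - 1)"
  have m: "m = - int k - 1" using False by (simp add: k_def)
  have "(\<Sum>i<Suc k. roof (x + of_int m * \<alpha> + real i * \<alpha>))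
     = roof (x + of_int m * \<alpha>) + (\<Sum>i<k. roof (x + of_int (m + 1) * \<alpha> + real i * \<alpha>))"
    by (subst sum.lessThan_Suc_shift) (simp add: algebra_simps)
  moreover have "cocycle (m + 1) x = - (\<Sum>i<k. roof (x + of_int (m + 1) * \<alpha> + real i * \<alpha>))"
    by (cases k) (simp_all add: cocycle_def m nat_add_distrib)
  moreover have "cocycle m x = - (\<Sum>i<Suc k. roof (x + of_int m * \<alpha> + real i * \<alpha>))"
    using False by (simp add: cocycle_def m nat_add_distrib del: sum.lessThan_Suc)
  ultimately show ?thesis by simp
qed

lemma cocycle_add: "cocycle (m + n) x = cocycle n x + cocycle m (x + of_int n * \<alpha>)"
proof (induction m rule: int_induct[of _ 0])
  case base then show ?case by simp
next
  case (step1 i)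
  have "cocycle (i + 1 + n) x = cocycle (i + n) x + roof (x + of_int (i + n) * \<alpha>)"
    using cocycle_succ[of "i + n" x] by (simp add: algebra_simps)
  then show ?case using step1 cocycle_succ[of i "x + of_int n * \<alpha>"] by (simp add: algebra_simps)
next
  case (step2 i)
  have "cocycle (i + n) x = cocycle (i - 1 + n) x + roof (x + of_int (i - 1 + n) * \<alpha>)"
    using cocycle_succ[of "i - 1 + n" x] by (simp add: algebra_simps)
  then show ?case using step2 cocycle_succ[of "i - 1" "x + of_int n * \<alpha>"] by (simp add: algebra_simps)
qed

lemma cocycle_frac: "cocycle m (frac x) = cocycle m x"
proof -
  have "roof (frac x + t) = roof (x + t)" for t
    using roof_frac[of "frac x + t"] roof_frac[of "x + t"] by simp
  then show ?thesis by (simp add: cocycle_def add.assoc)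
qed

lemma borel_measurable_roof: "roof \<in> borel_measurable borel"
  by (rule borel_measurable_continuous_onI[OF continuous_roof])

lemma borel_measurable_cocycle: "cocycle m \<in> borel_measurable borel"
  using borel_measurable_roof unfolding cocycle_def by measurable

lemma cocycle_mono: "m \<le> n \<Longrightarrow> cocycle m x + of_int (n - m) \<le> cocycle n x"
proof (induction n rule: int_ge_induct)
  case (step i)
  then show ?case using cocycle_succ[of i x] roof_ge_1[of "x + of_int i * \<alpha>"] by simp
qed simp

text \<open>As the roof is at least 1, the cocycle increases strictly and is unbounded both ways.
  This makes the definite description in \<open>special_flow\<close> meaningful.\<close>

lemma ex1_cocycle_interval: "\<exists>!n. cocycle n x \<le> t \<and> t < cocycle (n + 1) x"
proof (rule ex_ex1I)
  \<comment> \<open>A starting index at which the cocycle is already below t; the first crossing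
    after it is the required index.\<close>
  define N where "N = - \<lceil>\<bar>t\<bar>\<rceil>"
  have N: "N \<le> 0" "of_int N \<le> t" unfolding N_def by linarith+
  have low: "cocycle N x \<le> t" using cocycle_mono[OF N(1), of x] N(2) by simp
  have "t < cocycle (N + int (nat (\<lceil>\<bar>t\<bar>\<rceil> - N)) + 1) x"
    using cocycle_mono[of 0 "\<lceil>\<bar>t\<bar>\<rceil> + 1" x] by (simp add: N_def) linarith
  then have ex: "\<exists>k::nat. t < cocycle (N + int k + 1) x" by blast
  define k where "k = (LEAST k::nat. t < cocycle (N + int k + 1) x)"
  have "t < cocycle (N + int k + 1) x" unfolding k_def using ex by (rule LeastI_ex)
  moreover have "cocycle (N + int k) x \<le> t"
  proof (cases k)
    case (Suc j)
    then have "\<not> t < cocycle (N + int j + 1) x" 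
      using not_less_Least[of j "\<lambda>k. t < cocycle (N + int k + 1) x"] unfolding k_def by simp
    then show ?thesis by (simp add: Suc algebra_simps)
  qed (use low in simp)
  ultimately show "\<exists>n. cocycle n x \<le> t \<and> t < cocycle (n + 1) x" by blast
next
  fix n n' assume *: "cocycle n x \<le> t \<and> t < cocycle (n + 1) x" "cocycle n' x \<le> t \<and> t < cocycle (n' + 1) x"
  have "\<not> n < n'" if "t < cocycle (n + 1) x" "cocycle n' x \<le> t" for n n'
    using cocycle_mono[of "n + 1" n' x] that by auto
  then show "n = n'" using * by (meson linorder_less_linear)
qed

lemma birkhoff_sum_roof: "birkhoff_sum circle (rotation \<alpha>) roof n (frac x) = cocycle n x"
  by (simp add: birkhoff_sum_def cocycle_def rotation_funpow ziter_rotation roof_frac)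

lemma skew_orbit_roof:
  "skew_orbit circle (rotation \<alpha>) roof (frac x, r) = range (\<lambda>n. (frac (x + of_int n * \<alpha>), r + cocycle n x))"
proof -
  have "inj_on (skew (rotation \<alpha>) roof) ({0..<1} \<times> UNIV)"
    using inj_on_rotation[of \<alpha>] by (auto simp: inj_on_def skew_def)
  from ziter_orbit[OF this, of "\<lambda>n. (frac (x + of_int n * \<alpha>), r + cocycle n x)"]
  have "ziter ({0..<1} \<times> UNIV) (skew (rotation \<alpha>) roof) n (frac x, r)
      = (frac (x + of_int n * \<alpha>), r + cocycle n x)" for n
    by (simp add: skew_def rotation_def frac_lt_1 roof_frac cocycle_succ algebra_simps)
  then show ?thesis by (simp add: skew_orbit_def)
qed

lemma skew_orbit_shift:
  "skew_orbit circle (rotation \<alpha>) roof (frac (x + of_int m * \<alpha>), r + cocycle m x) =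
   skew_orbit circle (rotation \<alpha>) roof (frac x, r)"
proof -
  let ?\<phi> = "\<lambda>n. (frac (x + of_int n * \<alpha>), r + cocycle n x)"
  have "skew_orbit circle (rotation \<alpha>) roof (frac (x + of_int m * \<alpha>), r + cocycle m x)
      = range (\<lambda>n. ?\<phi> (n + m))"
    unfolding skew_orbit_roof by (simp add: cocycle_add algebra_simps)
  also have "\<dots> = ?\<phi> ` range (\<lambda>n. n + m)" by (simp only: image_image)
  also have "range (\<lambda>n. n + m) = UNIV" by (simp add: surj_plus_right)
  finally show ?thesis by (simp only: skew_orbit_roof)
qed

text \<open>The space under the roof is a fundamental domain: each skew product orbit has exactly
  one representative in it, namely the point reached by the flow.\<close>

lemma special_flow_orbit:
  assumes "x \<in> {0..<1}"
  shows "(THE y. y \<in> special_space circle roof \<and>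
      orbit_of circle (rotation \<alpha>) roof y = skew_orbit circle (rotation \<alpha>) roof (x, - (t + s)))
    = special_flow circle (rotation \<alpha>) roof t (x, s)"
proof -
  have x: "frac x = x" using assms by (simp add: frac_eq)
  obtain n where n: "cocycle n x \<le> t + s" "t + s < cocycle (n + 1) x"
    and uniq: "\<And>k. cocycle k x \<le> t + s \<Longrightarrow> t + s < cocycle (k + 1) x \<Longrightarrow> k = n"
    using ex1_cocycle_interval[of x "t + s"] by blast
  have bs: "birkhoff_sum circle (rotation \<alpha>) roof k x = cocycle k x" for k
    using birkhoff_sum_roof[of k x] by (simp add: x)
  have "(THE k. cocycle k x \<le> t + s \<and> t + s < cocycle (k + 1) x) = n"
    by (rule the_equality) (use n in simp, use uniq in blast)
  then have flow: "special_flow circle (rotation \<alpha>) roof t (x, s) = (frac (x + of_int n * \<alpha>), t + s - cocycle n x)"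
    using ziter_rotation[of \<alpha> n x] by (simp add: special_flow_def bs x)
  show ?thesis unfolding flow
  proof (rule the_equality)
    have "- (t + s - cocycle n x) = - (t + s) + cocycle n x" by simp
    then have "skew_orbit circle (rotation \<alpha>) roof (frac (x + of_int n * \<alpha>), - (t + s - cocycle n x))
        = skew_orbit circle (rotation \<alpha>) roof (x, - (t + s))"
      using skew_orbit_shift[of x n "- (t + s)"] by (simp only: x)
    moreover have "(frac (x + of_int n * \<alpha>), t + s - cocycle n x) \<in> special_space circle roof"
      using n cocycle_succ[of n x] by (simp add: special_space_def roof_frac frac_lt_1)
    ultimately show "(frac (x + of_int n * \<alpha>), t + s - cocycle n x) \<in> special_space circle roof \<and>
      orbit_of circle (rotation \<alpha>) roof (frac (x + of_int n * \<alpha>), t + s - cocycle n x) =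
        skew_orbit circle (rotation \<alpha>) roof (x, - (t + s))"
      by (simp only: orbit_of_def prod.case)
  next
    fix y assume y: "y \<in> special_space circle roof \<and>
      orbit_of circle (rotation \<alpha>) roof y = skew_orbit circle (rotation \<alpha>) roof (x, - (t + s))"
    obtain z r where yz: "y = (z, r)" by (cases y)
    have z: "z \<in> {0..<1}" "0 \<le> r" "r < roof z" using y yz by (auto simp: special_space_def)
    then have fz: "frac z = z" by (simp add: frac_eq)
    have "(z, - r) \<in> skew_orbit circle (rotation \<alpha>) roof (frac z, - r)"
      unfolding skew_orbit_roof by (rule range_eqI[of _ _ 0]) (simp add: fz)
    then have "(z, - r) \<in> skew_orbit circle (rotation \<alpha>) roof (frac x, - (t + s))"
      using y by (simp add: yz orbit_of_def fz x)
    then obtain k where k: "z = frac (x + of_int k * \<alpha>)" "- r = - (t + s) + cocycle k x"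
      unfolding skew_orbit_roof by auto
    have "k = n"
      by (rule uniq) (use z k cocycle_succ[of k x] in \<open>auto simp: roof_frac\<close>)
    then show "y = (frac (x + of_int n * \<alpha>), t + s - cocycle n x)"
      using k yz by simp
  qed
qed

text \<open>The identity with constant transfer function -t induces the time t map; the sign comes
  from identifying (x, s) with the orbit of (x, -s).\<close>

lemma special_flow_liftable:
  "ae_class (special_measure circle roof) (special_flow circle (rotation \<alpha>) roof t)
     \<in> liftable_centralizer circle (rotation \<alpha>) roof"
proof -
  let ?I = "induced_map circle (rotation \<alpha>) roof (\<lambda>x. x) (\<lambda>_. - t)"
  have "?I y = special_flow circle (rotation \<alpha>) roof t y" if "y \<in> special_space circle roof" for y
  proof -
    obtain x s where y: "y = (x, s)" by (cases y)
    then have "x \<in> {0..<1}" using that by (simp add: special_space_def)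
    from special_flow_orbit[OF this, of t s] show ?thesis
      by (simp add: y induced_map_def skew_def add.commute)
  qed
  then have "AE y in special_measure circle roof. ?I y = special_flow circle (rotation \<alpha>) roof t y"
    using AE_special_measure_fst[OF borel_measurable_circle[OF borel_measurable_roof], of "\<lambda>_. True"]
    by (auto elim: eventually_mono)
  then have "ae_class (special_measure circle roof) (special_flow circle (rotation \<alpha>) roof t)
      = ae_class (special_measure circle roof) ?I"
    unfolding ae_class_def by (auto elim: eventually_elim2)
  moreover have "automorphism circle (\<lambda>x. x)"
    unfolding automorphism_def by (auto simp: distr_id2 intro!: exI[of _ "\<lambda>x. x"])
  ultimately show ?thesis unfolding liftable_centralizer_def
    by (intro CollectI exI[of _ "\<lambda>x. x"] exI[of _ "\<lambda>_. - t"]) simp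
qed

end

section \<open>Triviality of the liftable centralizer\<close>

context convergents
begin

text \<open>Almost everywhere S is the m-th iterate of the rotation and g is
  \<open>cocycle m\<close> plus a constant c. So the lift is the m-th power of the skew product,
  which fixes every orbit, followed by a vertical translation by c, that is, the flow at time
  -c.\<close>

lemma liftable_imp_special_flow:
  assumes irr: "\<alpha> \<notin> \<rat>" and S: "S \<in> circle \<rightarrow>\<^sub>M circle" and g: "g \<in> borel_measurable circle"
    and comm: "AE x in circle. S (rotation \<alpha> x) = rotation \<alpha> (S x)"
    and cob: "AE x in circle. roof (S x) - roof x = g (rotation \<alpha> x) - g x"
  shows "\<exists>t. AE y in special_measure circle roof.
    induced_map circle (rotation \<alpha>) roof S g y = special_flow circle (rotation \<alpha>) roof t y"
proof -
  obtain \<beta> where \<beta>: "AE x in circle. S x = rotation \<beta> x"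
    using commuting_with_rotation[OF S irr comm] by blast
  have "AE x in circle. roof (rotation \<beta> x) - roof x = g (rotation \<alpha> x) - g x"
    using cob \<beta> by eventually_elim simp
  then obtain m k :: int where mk: "\<beta> = of_int m * \<alpha> + of_int k"
    using roof_coboundary[OF g] by blast
  have rot: "rotation \<beta> x = frac (x + of_int m * \<alpha>)" for x
    using frac_add_of_int[of "x + of_int m * \<alpha>" k] by (simp add: rotation_def mk add.assoc)
  \<comment> \<open>The functions g and \<open>cocycle m\<close> solve the same functional equation,
    so their difference is invariant and ergodicity applies.\<close>
  have "AE x in circle. g (rotation \<alpha> x) - cocycle m (rotation \<alpha> x) = g x - cocycle m x"
    using cob \<beta>
  proof eventually_elim
    case (elim x)
    have "cocycle m (rotation \<alpha> x) = cocycle (m + 1) x - roof x"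
      using cocycle_add[of m 1 x] cocycle_succ[of 0 x] by (simp add: rotation_def cocycle_frac)
    also have "\<dots> = cocycle m x + (roof (S x) - roof x)"
      using elim(2) by (simp add: cocycle_succ rot roof_frac)
    finally show ?case using elim(1) by simp
  qed
  moreover have "(\<lambda>x. g x - cocycle m x) \<in> borel_measurable circle"
    by (intro borel_measurable_diff g borel_measurable_circle borel_measurable_cocycle)
  ultimately obtain c where c: "AE x in circle. g x - cocycle m x = c"
    using rotation_ergodic[OF _ irr] by blast
  have "AE y in special_measure circle roof.
      (S (fst y) = rotation \<beta> (fst y) \<and> g (fst y) - cocycle m (fst y) = c) \<and> y \<in> special_space circle roof"
    using \<beta> c by (intro AE_special_measure_fst borel_measurable_circle borel_measurable_roof) (rule AE_conjI)
  then have "AE y in special_measure circle roof.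
      induced_map circle (rotation \<alpha>) roof S g y = special_flow circle (rotation \<alpha>) roof (- c) y"
  proof eventually_elim
    case (elim y)
    obtain x s where y: "y = (x, s)" by (cases y)
    have x: "x \<in> {0..<1}" using elim y by (simp add: special_space_def)
    have "g x = cocycle m x + c" using elim y by simp
    then have "- s + g x = - (- c + s) + cocycle m x" by simp
    then have "skew S g (x, - s) = (frac (x + of_int m * \<alpha>), - (- c + s) + cocycle m x)"
      using elim y by (simp only: skew_def prod.case fst_conv rot)
    then have "skew_orbit circle (rotation \<alpha>) roof (skew S g (x, - s))
        = skew_orbit circle (rotation \<alpha>) roof (x, - (- c + s))"
      using skew_orbit_shift[of x m "- (- c + s)"] frac_eq_id[OF x] by (simp only:)
    then show ?case using special_flow_orbit[OF x, of "- c" s] by (simp only: y induced_map_def prod.case)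
  qed
  then show ?thesis by blast
qed

lemma liftable_centralizer_roof:
  assumes "\<alpha> \<notin> \<rat>"
  shows "liftable_centralizer circle (rotation \<alpha>) roof =
    {ae_class (special_measure circle roof) (special_flow circle (rotation \<alpha>) roof t) | t. True}"
proof (intro equalityI subsetI)
  fix Q assume "Q \<in> liftable_centralizer circle (rotation \<alpha>) roof"
  then obtain S g where Q: "Q = ae_class (special_measure circle roof) (induced_map circle (rotation \<alpha>) roof S g)"
      and S: "automorphism circle S" "AE x in circle. S (rotation \<alpha> x) = rotation \<alpha> (S x)"
      and g: "g \<in> borel_measurable circle" "AE x in circle. roof (S x) - roof x = g (rotation \<alpha> x) - g x"
    unfolding liftable_centralizer_def by blast
  have "S \<in> circle \<rightarrow>\<^sub>M circle" using S(1) by (simp add: automorphism_def)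
  from liftable_imp_special_flow[OF assms this g(1) S(2) g(2)] obtain t where
    t: "AE y in special_measure circle roof.
      induced_map circle (rotation \<alpha>) roof S g y = special_flow circle (rotation \<alpha>) roof t y" by blast
  then have "Q = ae_class (special_measure circle roof) (special_flow circle (rotation \<alpha>) roof t)"
    unfolding Q ae_class_def by (auto elim: eventually_elim2)
  then show "Q \<in> {ae_class (special_measure circle roof) (special_flow circle (rotation \<alpha>) roof t) | t. True}"
    by blast
qed (use special_flow_liftable in blast)

end

theorem proposition9p8:
  fixes \<alpha> :: real
  assumes "\<alpha> \<notin> \<rat>" and "bounded_partial_quotients \<alpha>"
  shows "\<exists>F :: real \<Rightarrow> real.
    (\<forall>x\<in>{0..<1}. F x > 0) \<and>
    (\<forall>\<kappa>. 0 < \<kappa> \<and> \<kappa> < 1 \<longrightarrow> holder_on_circle \<kappa> F) \<and>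
    (\<forall>\<beta> :: real.
       (\<exists>g \<in> borel_measurable circle.
          AE x in circle. F (rotation \<beta> x) - F x = g (rotation \<alpha> x) - g x)
       \<longrightarrow> (\<exists>m n :: int. \<beta> = of_int m * \<alpha> + of_int n)) \<and>
    liftable_centralizer circle (rotation \<alpha>) F =
      {ae_class (special_measure circle F) (special_flow circle (rotation \<alpha>) F t) | t. True}"
proof -
  obtain q p a A where "convergents \<alpha> q p a A"
    using bounded_partial_quotients_convergents[OF assms] by blast
  then interpret convergents \<alpha> q p a A .
  show ?thesis
  proof (intro exI[of _ roof] conjI ballI allI impI)
    show "0 < roof x" for x using roof_ge_1[of x] by linarith
    show "holder_on_circle \<kappa> roof" if "0 < \<kappa> \<and> \<kappa> < 1" for \<kappa> using holder_roof that by blast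
    show "\<exists>m n :: int. \<beta> = of_int m * \<alpha> + of_int n"
      if "\<exists>g \<in> borel_measurable circle. AE x in circle. roof (rotation \<beta> x) - roof x = g (rotation \<alpha> x) - g x" for \<beta>
      using that roof_coboundary by blast
  qed (rule liftable_centralizer_roof[OF assms(1)])
qed

end
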